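(* Let $\mu$ be an arbitrary Young diagram and let $D(\mu)$ be the set of Young diagrams $\lambda$ with $|\lambda|\le|\mu|$ and $\lambda\ne\mu$. Assume that the complex numbers $a_i$ ($i\in\mathbb Z$) are pairwise distinct. Then, as an element of $\Lambda$, $s_{\mu;a}$ is uniquely determined by the following two properties: first, its top degree homogeneous component is the Schur function $s_\mu$; second, it vanishes at $(x(\lambda);y(\lambda))$ for all $\lambda\in D(\mu)$.
   Context: The base field is $\mathbb C$. $\Lambda=\mathbb C[\mathbf p_1,\mathbf p_2,\dots]$ is the algebra of symmetric functions, graded by $\deg\mathbf p_k=k$. Its elements $h_k$ are defined by $H(u)=1+\sum_{k\ge1}h_ku^{-k}=\exp\big(\sum_{k\ge1}\mathbf p_ku^{-k}/k\big)\in\Lambda[[u^{-1}]]$, with $h_0=1$, $h_k=0$ for $k<0$. The Schur function is $s_\mu=\det[h_{\mu_i-i+j}]$ (order any number $\ge\ell(\mu)$). For $f\in\Lambda$, $f(x;y)$ denotes the result of substituting $\mathbf p_k\mapsto\sum_ix_i^k+(-1)^{k-1}\sum_iy_i^k$. For $a=(a_i)_{i\in\mathbb Z}$, the elements $h_{k;a}\in\Lambda$ are defined by $1+\sum_{k\ge1}\frac{h_{k;a}}{(u-a_1)\cdots(u-a_k)}=H(u)$ in $\Lambda[[u^{-1}]]$, with $h_{0;a}=1$, $h_{k;a}=0$ for $k<0$. For $r\in\mathbb Z$, $(\tau^ra)_i=a_{i+r}$. The multiparameter Schur function is $s_{\mu;a}=\det[h_{\mu_i-i+j;\,\tau^{1-j}a}]$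 (order any number $\ge\ell(\mu)$). Put $\widehat a_i=-a_{-i+1}$. For a Young diagram $\lambda$ with $D$ diagonal squares and Frobenius coordinates $P_i=\lambda_i-i$, $Q_i=\lambda'_i-i$ ($1\le i\le D$, $\lambda'$ the transposed diagram), set $x(\lambda)_i=a_{P_i+1}$, $y(\lambda)_i=\widehat a_{Q_i+1}$ for $1\le i\le D$, and $x(\lambda)_i=y(\lambda)_i=0$ for $i>D$. An element $f\in\Lambda$ vanishes at $(x(\lambda);y(\lambda))$ if $f(x(\lambda);y(\lambda))=0$. *)

theory Defs
  imports
    "HOL-Library.Poly_Mapping"
    "HOL-Computational_Algebra.Formal_Power_Series"
    "Jordan_Normal_Form.Determinant"
begin

section \<open>The algebra of symmetric functions\<close>

text \<open>
  The algebra \<open>\<Lambda> = \<complex>[p\<^sub>1, p\<^sub>2, \<dots>]\<close>. A monomial is a finitely supported exponent function on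
  \<open>nat\<close>; since the generators are numbered from 1, the exponent of \<open>p\<^sub>k\<close> is stored
  at index \<open>k - 1\<close>, i.e. index \<open>i\<close> belongs to \<open>p\<^sub>i\<^sub>+\<^sub>1\<close>.
\<close>

type_synonym symfun = "(nat \<Rightarrow>\<^sub>0 nat) \<Rightarrow>\<^sub>0 complex"

definition const_sym :: "complex \<Rightarrow> symfun" where
  "const_sym c = Poly_Mapping.single 0 c"

text \<open>Only meaningful for \<open>k \<ge> 1\<close>.\<close>

definition power_sum :: "nat \<Rightarrow> symfun" where
  "power_sum k = Poly_Mapping.single (Poly_Mapping.single (k - 1) 1) 1"

definition monom_degree :: "(nat \<Rightarrow>\<^sub>0 nat) \<Rightarrow> nat" where
  "monom_degree m = (\<Sum>i\<in>Poly_Mapping.keys m. (i + 1) * Poly_Mapping.lookup m i)"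

definition homogeneous_component :: "nat \<Rightarrow> symfun \<Rightarrow> symfun" where
  "homogeneous_component d f =
     (\<Sum>m\<in>{m \<in> Poly_Mapping.keys f. monom_degree m = d}.
        Poly_Mapping.single m (Poly_Mapping.lookup f m))"

text \<open>For \<open>f = 0\<close>, whose degree is undefined, the top component is \<open>0\<close>.\<close>

definition top_component :: "symfun \<Rightarrow> symfun" where
  "top_component f =
     (if f = 0 then 0
      else homogeneous_component (Max (monom_degree ` Poly_Mapping.keys f)) f)"

text \<open>The algebra homomorphism \<open>\<Lambda> \<rightarrow> \<complex>\<close> with \<open>p\<^sub>k \<mapsto> \<phi> k\<close> for \<open>k \<ge> 1\<close>.\<close>

definition eval_sym :: "(nat \<Rightarrow> complex) \<Rightarrow> symfun \<Rightarrow> complex" where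
  "eval_sym \<phi> f =
     (\<Sum>m\<in>Poly_Mapping.keys f. Poly_Mapping.lookup f m *
        (\<Prod>i\<in>Poly_Mapping.keys m. \<phi> (i + 1) ^ Poly_Mapping.lookup m i))"

text \<open>
  \<open>f(x;y)\<close> for sequences \<open>(x\<^sub>i)\<close>, \<open>(y\<^sub>i)\<close>, \<open>i \<ge> 1\<close>, with finitely many nonzero terms. Only
  \<open>k \<ge> 1\<close> is ever used, so the zero terms contribute nothing to the power sums.
\<close>

definition super_eval :: "symfun \<Rightarrow> (nat \<Rightarrow> complex) \<Rightarrow> (nat \<Rightarrow> complex) \<Rightarrow> complex" where
  "super_eval f x y =
     eval_sym (\<lambda>k. (\<Sum>i | 1 \<le> i \<and> x i \<noteq> 0. x i ^ k)
                 + (-1) ^ (k - 1) * (\<Sum>i | 1 \<le> i \<and> y i \<noteq> 0. y i ^ k)) f"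

section \<open>Complete and multiparameter complete functions\<close>

text \<open>
  \<open>\<Lambda>[[u\<^sup>-\<^sup>1]]\<close> is \<open>symfun fps\<close>, with \<open>fps_X\<close> in the role of \<open>u\<^sup>-\<^sup>1\<close>. Complex power series are
  embedded coefficientwise, because \<^typ>\<open>symfun\<close> is not a field and so \<open>exp\<close> and inverses are
  only available over \<open>complex\<close>.
\<close>

definition lift_fps :: "complex fps \<Rightarrow> symfun fps" where
  "lift_fps F = Abs_fps (\<lambda>n. const_sym (fps_nth F n))"

definition H_series :: "symfun fps" where
  "H_series = fps_compose (lift_fps (fps_exp 1))
     (Abs_fps (\<lambda>k. if k = 0 then 0 else const_sym (1 / of_nat k) * power_sum k))"

definition complete_h :: "int \<Rightarrow> symfun" where
  "complete_h k = (if k < 0 then 0 else fps_nth H_series (nat k))"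

text \<open>\<open>1/(u - c) = u\<^sup>-\<^sup>1 (1 - c u\<^sup>-\<^sup>1)\<^sup>-\<^sup>1\<close>.\<close>

definition inv_u_minus :: "complex \<Rightarrow> complex fps" where
  "inv_u_minus c = fps_X * inverse (1 - fps_const c * fps_X)"

text \<open>
  The sum below converges in the usual (\<open>u\<^sup>-\<^sup>1\<close>-adic) topology on formal power series; its
  \<open>k\<close>-th term is \<open>g k / ((u - a\<^sub>1) \<cdots> (u - a\<^sub>k))\<close>.
\<close>

definition is_multi_h :: "(int \<Rightarrow> complex) \<Rightarrow> (nat \<Rightarrow> symfun) \<Rightarrow> bool" where
  "is_multi_h a g \<longleftrightarrow> g 0 = 1 \<and>
     (\<lambda>k. fps_const (g k) * lift_fps (\<Prod>i=1..k. inv_u_minus (a (int i)))) sums H_series"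

definition multi_h :: "(int \<Rightarrow> complex) \<Rightarrow> int \<Rightarrow> symfun" where
  "multi_h a k = (if k < 0 then 0 else (THE g. is_multi_h a g) (nat k))"

definition seq_shift :: "int \<Rightarrow> (int \<Rightarrow> complex) \<Rightarrow> int \<Rightarrow> complex" where
  "seq_shift r a i = a (i + r)"

section \<open>Young diagrams\<close>

text \<open>A Young diagram is given by the weakly decreasing list of its nonzero row lengths.\<close>

definition is_diagram :: "nat list \<Rightarrow> bool" where
  "is_diagram la \<longleftrightarrow> sorted_wrt (\<ge>) la \<and> 0 \<notin> set la"

text \<open>Rows and columns are numbered from 1.\<close>

definition row_len :: "nat list \<Rightarrow> nat \<Rightarrow> nat" where
  "row_len la i = (if 1 \<le> i \<and> i \<le> length la then la ! (i - 1) else 0)"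

definition col_len :: "nat list \<Rightarrow> nat \<Rightarrow> nat" where
  "col_len la j = card {i. 1 \<le> i \<and> i \<le> length la \<and> j \<le> row_len la i}"

definition diag_len :: "nat list \<Rightarrow> nat" where
  "diag_len la = card {i. 1 \<le> i \<and> i \<le> length la \<and> i \<le> row_len la i}"

definition frob_P :: "nat list \<Rightarrow> nat \<Rightarrow> int" where
  "frob_P la i = int (row_len la i) - int i"

definition frob_Q :: "nat list \<Rightarrow> nat \<Rightarrow> int" where
  "frob_Q la i = int (col_len la i) - int i"

definition dual_seq :: "(int \<Rightarrow> complex) \<Rightarrow> int \<Rightarrow> complex" where
  "dual_seq a i = - a (- i + 1)"

definition x_pt :: "(int \<Rightarrow> complex) \<Rightarrow> nat list \<Rightarrow> nat \<Rightarrow> complex" where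
  "x_pt a la i = (if 1 \<le> i \<and> i \<le> diag_len la then a (frob_P la i + 1) else 0)"

definition y_pt :: "(int \<Rightarrow> complex) \<Rightarrow> nat list \<Rightarrow> nat \<Rightarrow> complex" where
  "y_pt a la i = (if 1 \<le> i \<and> i \<le> diag_len la then dual_seq a (frob_Q la i + 1) else 0)"

definition vanishes_at :: "(int \<Rightarrow> complex) \<Rightarrow> symfun \<Rightarrow> nat list \<Rightarrow> bool" where
  "vanishes_at a f la \<longleftrightarrow> super_eval f (x_pt a la) (y_pt a la) = 0"

section \<open>Schur functions\<close>

text \<open>The determinant \<open>det[e\<^sub>i\<^sub>j]\<close> with \<open>i, j = 1, \<dots>, n\<close>; matrix indices of the library start at 0.\<close>

definition det_from_1 :: "nat \<Rightarrow> (nat \<Rightarrow> nat \<Rightarrow> symfun) \<Rightarrow> symfun" where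
  "det_from_1 n e = det (mat n n (\<lambda>(i, j). e (i + 1) (j + 1)))"

definition schur_order :: "nat \<Rightarrow> nat list \<Rightarrow> symfun" where
  "schur_order n \<mu> = det_from_1 n (\<lambda>i j. complete_h (int (row_len \<mu> i) - int i + int j))"

definition multi_schur_order :: "nat \<Rightarrow> (int \<Rightarrow> complex) \<Rightarrow> nat list \<Rightarrow> symfun" where
  "multi_schur_order n a \<mu> =
     det_from_1 n (\<lambda>i j. multi_h (seq_shift (1 - int j) a) (int (row_len \<mu> i) - int i + int j))"

text \<open>
  Any order \<open>n \<ge> \<ell>(\<mu>)\<close> gives the same function, see \<open>schur_order_eq\<close> and
  \<open>multi_schur_order_eq\<close> below.
\<close>

definition schur :: "nat list \<Rightarrow> symfun" where
  "schur \<mu> = schur_order (length \<mu>) \<mu>"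

definition multi_schur :: "(int \<Rightarrow> complex) \<Rightarrow> nat list \<Rightarrow> symfun" where
  "multi_schur a \<mu> = multi_schur_order (length \<mu>) a \<mu>"

section \<open>The definitions are meaningful\<close>

lemma const_sym_0 [simp]: "const_sym 0 = 0"
  and const_sym_1 [simp]: "const_sym 1 = 1"
  by (simp_all add: const_sym_def)

lemma H_series_nth_0: "fps_nth H_series 0 = 1"
  by (simp add: H_series_def lift_fps_def fps_compose_nth)

lemma complete_h_0 [simp]: "complete_h 0 = 1"
  by (simp add: complete_h_def H_series_nth_0)

lemma prod_inv_u_minus:
  "(\<Prod>i=1..k. inv_u_minus (a (int i))) =
     fps_X ^ k * (\<Prod>i=1..k. inverse (1 - fps_const (a (int i)) * fps_X))"
  by (simp add: inv_u_minus_def prod.distrib)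

lemma lift_prod_nth_less:
  assumes "n < k"
  shows "fps_nth (lift_fps (\<Prod>i=1..k. inv_u_minus (a (int i)))) n = 0"
  using assms by (simp only: prod_inv_u_minus lift_fps_def fps_nth_Abs_fps fps_X_power_mult_nth) simp

lemma lift_prod_nth_eq: "fps_nth (lift_fps (\<Prod>i=1..k. inv_u_minus (a (int i)))) k = 1"
proof -
  have "fps_nth (\<Prod>i=1..k. inverse (1 - fps_const (a (int i)) * fps_X)) 0 = 1"
    by (induction k) simp_all
  then show ?thesis
    by (simp only: prod_inv_u_minus lift_fps_def fps_nth_Abs_fps fps_X_power_mult_nth) simp
qed

lemma triangular_sums_iff:
  fixes T :: "nat \<Rightarrow> symfun fps"
  assumes "\<And>n k. n < k \<Longrightarrow> fps_nth (T k) n = 0"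
  shows "(\<lambda>k. fps_const (g k) * T k) sums F \<longleftrightarrow>
    (\<forall>n. (\<Sum>k\<le>n. g k * fps_nth (T k) n) = fps_nth F n)"
proof -
  have stable: "fps_nth (\<Sum>k<N. fps_const (g k) * T k) n = (\<Sum>k\<le>n. g k * fps_nth (T k) n)"
    if "n < N" for n N
    unfolding fps_sum_nth fps_mult_left_const_nth
    by (rule sum.mono_neutral_right) (use that assms in auto)
  have ev: "eventually (\<lambda>N. fps_nth (\<Sum>k<N. fps_const (g k) * T k) n
      = (\<Sum>k\<le>n. g k * fps_nth (T k) n)) sequentially" for n
    using eventually_gt_at_top[of n] by eventually_elim (rule stable)
  show ?thesis
    unfolding sums_def tendsto_fps_iff
  proof (intro iff_allI iffI)
    fix n
    assume "eventually (\<lambda>N. fps_nth (\<Sum>k<N. fps_const (g k) * T k) n = fps_nth F n) sequentially"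
    with ev[of n] have "eventually (\<lambda>N. (\<Sum>k\<le>n. g k * fps_nth (T k) n) = fps_nth F n) (sequentially)"
      by eventually_elim simp
    then show "(\<Sum>k\<le>n. g k * fps_nth (T k) n) = fps_nth F n" by simp
  next
    fix n
    assume "(\<Sum>k\<le>n. g k * fps_nth (T k) n) = fps_nth F n"
    with ev[of n]
    show "eventually (\<lambda>N. fps_nth (\<Sum>k<N. fps_const (g k) * T k) n = fps_nth F n) sequentially"
      by simp
  qed
qed

lemma is_multi_h_unique_existence: "\<exists>!g. is_multi_h a g"
proof -
  define T where "T k = lift_fps (\<Prod>i=1..k. inv_u_minus (a (int i)))" for k
  have T_less: "fps_nth (T k) n = 0" if "n < k" for n k
    using that unfolding T_def by (rule lift_prod_nth_less)
  have T_eq [simp]: "fps_nth (T k) k = 1" for k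
    unfolding T_def by (rule lift_prod_nth_eq)
  have iff: "is_multi_h a g \<longleftrightarrow>
      g 0 = 1 \<and> (\<forall>n. g n = fps_nth H_series n - (\<Sum>k<n. g k * fps_nth (T k) n))" for g
  proof -
    have "(\<lambda>k. fps_const (g k) * T k) sums H_series \<longleftrightarrow>
        (\<forall>n. g n = fps_nth H_series n - (\<Sum>k<n. g k * fps_nth (T k) n))"
      unfolding triangular_sums_iff[of T, OF T_less, simplified]
      by (simp add: lessThan_Suc_atMost [symmetric] eq_diff_eq add.commute)
    then show ?thesis by (simp add: is_multi_h_def T_def)
  qed
  define step where
    "step gs n = fps_nth H_series n - (\<Sum>k<n. gs k * fps_nth (T k) n)" for gs :: "nat \<Rightarrow> symfun" and n
  define g where "g = wfrec less_than step"
  have g: "g n = fps_nth H_series n - (\<Sum>k<n. g k * fps_nth (T k) n)" for n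
    unfolding g_def by (subst wfrec[OF wf_less_than]) (simp add: step_def cut_apply)
  show ?thesis
  proof (rule ex1I[of _ g])
    show "is_multi_h a g"
    proof (unfold iff, intro conjI allI)
      show "g 0 = 1"
        by (subst g) (simp add: H_series_nth_0)
    qed (rule g)
  next
    fix g'
    assume "is_multi_h a g'"
    then have g': "g' n = fps_nth H_series n - (\<Sum>k<n. g' k * fps_nth (T k) n)" for n
      unfolding iff by blast
    have "g' n = g n" for n
    proof (induction n rule: less_induct)
      case (less n)
      then show ?case
        unfolding g[of n] g'[of n] by simp
    qed
    then show "g' = g" by blast
  qed
qed

lemma is_multi_h_multi_h: "is_multi_h a (\<lambda>k. multi_h a (int k))"
  using theI'[OF is_multi_h_unique_existence[of a]] by (simp add: multi_h_def)

lemma multi_h_0 [simp]: "multi_h a 0 = 1"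
  using is_multi_h_multi_h[of a] by (simp add: is_multi_h_def)

lemma det_from_1_Suc:
  assumes "\<And>j. 1 \<le> j \<Longrightarrow> j \<le> n \<Longrightarrow> e (Suc n) j = 0" and "e (Suc n) (Suc n) = 1"
  shows "det_from_1 (Suc n) e = det_from_1 n e"
proof -
  let ?A1 = "mat n n (\<lambda>(i, j). e (i + 1) (j + 1))"
  let ?A2 = "mat n 1 (\<lambda>(i, j). e (i + 1) (Suc n))"
  let ?A4 = "mat 1 1 (\<lambda>_. 1 :: symfun)"
  have block: "mat (Suc n) (Suc n) (\<lambda>(i, j). e (i + 1) (j + 1))
      = four_block_mat ?A1 ?A2 (0\<^sub>m 1 n) ?A4"
    using assms by (intro eq_matI) (auto simp: less_Suc_eq)
  have "det ?A4 = 1"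
    by (simp add: det_single)
  then show ?thesis
    unfolding det_from_1_def block
    by (subst det_four_block_mat_lower_left_zero[of _ n _ 1]) auto
qed

lemma schur_order_eq:
  assumes "length \<mu> \<le> n"
  shows "schur_order n \<mu> = schur \<mu>"
  using assms
proof (induction n rule: dec_induct)
  case (step n)
  then have "schur_order (Suc n) \<mu> = schur_order n \<mu>"
    unfolding schur_order_def by (intro det_from_1_Suc) (auto simp: row_len_def complete_h_def[of "- 1 - _ + _"])
  with step show ?case by simp
qed (simp add: schur_def)

lemma multi_schur_order_eq:
  assumes "length \<mu> \<le> n"
  shows "multi_schur_order n a \<mu> = multi_schur a \<mu>"
  using assms
proof (induction n rule: dec_induct)
  case (step n)
  then have "multi_schur_order (Suc n) a \<mu> = multi_schur_order n a \<mu>"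
    unfolding multi_schur_order_def
    by (intro det_from_1_Suc) (auto simp: row_len_def multi_h_def[of _ "- 1 - _ + _"])
  with step show ?case by simp
qed (simp add: multi_schur_def)

end

theory Submission
  imports Defs
begin

text \<open>
  Write \<open>X = u\<^sup>-\<^sup>1\<close> and let \<open>\<lambda>\<close> be a diagram with at most \<open>n\<close> rows. The idea is to compute all values
  of multiparameter Schur functions at \<open>\<lambda>\<close> from one rational function. In terms of the rows instead
  of the Frobenius coordinates, the specialisation at \<open>(x(\<lambda>); y(\<lambda>))\<close> sends the generating series to
  \[ H(u) = \prod_{i=1}^n \frac{1 - a_{1-i} X}{1 - b_i X}, \qquad b_i = a_{\lambda_i - i + 1}, \]
  because the numbers \<open>i - \<lambda>'\<^sub>i\<close> coming from the columns are exactly those numbers in \<open>{1 - n..0}\<close>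
  that no row below the diagonal supplies (\<open>frobenius_complement\<close>, \<open>eval_H_series_diagram\<close>).

  The value of \<open>h\<^bsub>k;\<tau>\<^sup>r a\<^esub>\<close> is a coefficient of the expansion of this function in the basis
  \<open>1/((u - a\<^bsub>r+1\<^esub>) \<cdots> (u - a\<^bsub>r+k\<^esub>))\<close>. Division by \<open>u - a\<^sub>r\<close>, \<open>u - a\<^bsub>r-1\<^esub>\<close>, \<dots> merely shifts such
  coefficients, so all columns of the Jacobi-Trudi matrix can be read off in one common basis: column
  \<open>j\<close> consists of coefficients of a rational function \<open>F\<^sub>j\<close> with denominator \<open>\<Prod>(1 - b\<^sub>i X)\<close>
  (\<open>jacobi_trudi_entry\<close>). The simple poles \<open>1/(u - b\<^sub>l)\<close> are combinations of the \<open>F\<^sub>j\<close>, with a matrix of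
  coefficients that depends on \<open>\<lambda>\<close> only, and their own expansion coefficients are products
  \<open>\<Prod>(b\<^sub>l - a\<^sub>t)\<close>. Hence there is a number \<open>m\<close> depending on \<open>\<lambda>\<close> only such that for all \<open>\<mu>\<close>
  \[ s_{\mu;a}(\lambda) \cdot m = \det\Big[\prod_{t=1-n}^{\mu_i-i} (b_l - a_t)\Big] \]
  (\<open>eval_multi_schur_det\<close>). As the \<open>a\<^sub>t\<close> are distinct, an entry is nonzero iff
  \<open>\<mu>\<^sub>i - i \<le> \<lambda>\<^sub>l - l\<close>. A nonzero term of the determinant therefore forces \<open>|\<mu>| \<le> |\<lambda>|\<close>, and \<open>\<lambda> = \<mu>\<close> if
  \<open>|\<lambda>| \<le> |\<mu>|\<close>. For \<open>\<mu> = \<lambda>\<close> the identity gives the only nonzero term, so \<open>m \<noteq> 0\<close>. It follows that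
  \<open>s\<^bsub>\<mu>;a\<^esub>\<close> vanishes on \<open>D(\<mu>)\<close> (\<open>multi_schur_vanishes\<close>) and not at \<open>\<mu>\<close> (\<open>multi_schur_nonvanishing\<close>).

  The top component is \<open>s\<^sub>\<mu>\<close> since \<open>h\<^bsub>k;a\<^esub>\<close> equals \<open>h\<^sub>k\<close> up to lower degree
  (\<open>multi_schur_minus_schur\<close>).

  For uniqueness, two solutions differ by an element of degree less than \<open>|\<mu>|\<close> that vanishes at all
  diagrams with fewer than \<open>|\<mu>|\<close> boxes, and such an element is zero (\<open>vanishing_low_degree_eq_0\<close>):
  the \<open>s\<^bsub>\<nu>;a\<^esub>\<close> with \<open>|\<nu>| < N\<close> are triangular with respect to evaluation at these diagrams, hence
  linearly independent, and there are at least as many of them as monomials of degree less than \<open>N\<close>.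
  So they form a basis of that part of \<open>\<Lambda>\<close>, on which evaluation is then injective.
\<close>

section \<open>Specialisations of symmetric functions\<close>

definition mono_val :: "(nat \<Rightarrow> complex) \<Rightarrow> (nat \<Rightarrow>\<^sub>0 nat) \<Rightarrow> complex" where
  "mono_val \<phi> m = (\<Prod>i\<in>Poly_Mapping.keys m. \<phi> (i + 1) ^ Poly_Mapping.lookup m i)"

lemma mono_val_superset:
  assumes "finite A" "Poly_Mapping.keys m \<subseteq> A"
  shows "mono_val \<phi> m = (\<Prod>i\<in>A. \<phi> (i + 1) ^ Poly_Mapping.lookup m i)"
  unfolding mono_val_def using assms
  by (intro prod.mono_neutral_left) (auto simp: in_keys_iff)

lemma mono_val_add: "mono_val \<phi> (m + n) = mono_val \<phi> m * mono_val \<phi> n"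
proof -
  let ?A = "Poly_Mapping.keys m \<union> Poly_Mapping.keys n"
  have "mono_val \<phi> (m + n) = (\<Prod>i\<in>?A. \<phi> (i + 1) ^ Poly_Mapping.lookup (m + n) i)"
    by (rule mono_val_superset) (use keys_add[of m n] in auto)
  also have "\<dots> = mono_val \<phi> m * mono_val \<phi> n"
    by (simp add: mono_val_superset[of ?A] lookup_add power_add prod.distrib)
  finally show ?thesis .
qed

lemma eval_sym_superset:
  assumes "finite A" "Poly_Mapping.keys f \<subseteq> A"
  shows "eval_sym \<phi> f = (\<Sum>m\<in>A. Poly_Mapping.lookup f m * mono_val \<phi> m)"
  unfolding eval_sym_def mono_val_def using assms
  by (intro sum.mono_neutral_left) (auto simp: in_keys_iff)

lemma eval_sym_add: "eval_sym \<phi> (f + g) = eval_sym \<phi> f + eval_sym \<phi> g"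
proof -
  let ?A = "Poly_Mapping.keys f \<union> Poly_Mapping.keys g"
  have "eval_sym \<phi> (f + g) = (\<Sum>m\<in>?A. Poly_Mapping.lookup (f + g) m * mono_val \<phi> m)"
    by (rule eval_sym_superset) (use keys_add[of f g] in auto)
  then show ?thesis
    by (simp add: eval_sym_superset[of ?A] lookup_add ring_distribs sum.distrib)
qed

lemma eval_sym_0 [simp]: "eval_sym \<phi> 0 = 0"
  by (simp add: eval_sym_def)

lemma eval_sym_single [simp]: "eval_sym \<phi> (Poly_Mapping.single m c) = c * mono_val \<phi> m"
  by (subst eval_sym_superset[of "{m}"]) auto

lemma eval_sym_sum: "eval_sym \<phi> (\<Sum>i\<in>A. f i) = (\<Sum>i\<in>A. eval_sym \<phi> (f i))"
  by (induction A rule: infinite_finite_induct) (simp_all add: eval_sym_add)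

lemma symfun_eq_sum_monomials:
  fixes f :: symfun
  shows "f = (\<Sum>m\<in>Poly_Mapping.keys f. Poly_Mapping.single m (Poly_Mapping.lookup f m))"
  by (rule poly_mapping_eqI)
    (auto simp: lookup_sum lookup_single when_def in_keys_iff)

lemma eval_sym_mult: "eval_sym \<phi> (f * g) = eval_sym \<phi> f * eval_sym \<phi> g"
proof -
  define s where "s h m = Poly_Mapping.single m (Poly_Mapping.lookup h m)" for h :: symfun and m
  have s: "h = (\<Sum>m\<in>Poly_Mapping.keys h. s h m)" for h
    unfolding s_def by (rule symfun_eq_sum_monomials)
  have "eval_sym \<phi> ((\<Sum>m\<in>A. s f m) * (\<Sum>n\<in>B. s g n))
      = eval_sym \<phi> (\<Sum>m\<in>A. s f m) * eval_sym \<phi> (\<Sum>n\<in>B. s g n)" for A B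
    by (simp add: sum_product eval_sym_sum s_def mult_single mono_val_add mult_ac)
  with s[of f] s[of g] show ?thesis by metis
qed

lemma eval_sym_const [simp]: "eval_sym \<phi> (const_sym c) = c"
  by (simp add: const_sym_def mono_val_def)

lemma eval_sym_1 [simp]: "eval_sym \<phi> 1 = 1"
  using eval_sym_const[of \<phi> 1] by simp

lemma eval_sym_power_sum [simp]: "1 \<le> k \<Longrightarrow> eval_sym \<phi> (power_sum k) = \<phi> k"
  by (simp add: power_sum_def mono_val_def)

lemma eval_sym_hom: "comm_ring_hom (eval_sym \<phi>)"
  by unfold_locales (simp_all add: eval_sym_add eval_sym_mult)

lemma eval_sym_diff: "eval_sym \<phi> (f - g) = eval_sym \<phi> f - eval_sym \<phi> g"
  using eval_sym_add[of \<phi> "f - g" g] by simp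

lemma const_sym_add: "const_sym (a + b) = const_sym a + const_sym b"
  by (simp add: const_sym_def single_add)

lemma const_sym_mult: "const_sym (a * b) = const_sym a * const_sym b"
  by (simp add: const_sym_def mult_single)

section \<open>Degrees and top components\<close>

text \<open>
  Degree bounds are integers, so that degree less than \<open>d\<close> can be written as \<open>deg_le (d - 1)\<close> also
  for \<open>d = 0\<close>, and so that the entries \<open>h\<^sub>k = 0\<close> with \<open>k < 0\<close> of a Jacobi-Trudi matrix are homogeneous
  of degree \<open>k\<close> like all the others.
\<close>

definition deg_le :: "int \<Rightarrow> symfun \<Rightarrow> bool" where
  "deg_le d f \<longleftrightarrow> (\<forall>m\<in>Poly_Mapping.keys f. int (monom_degree m) \<le> d)"

definition homog :: "int \<Rightarrow> symfun \<Rightarrow> bool" where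
  "homog d f \<longleftrightarrow> (\<forall>m\<in>Poly_Mapping.keys f. int (monom_degree m) = d)"

lemma monom_degree_superset:
  assumes "finite A" "Poly_Mapping.keys m \<subseteq> A"
  shows "monom_degree m = (\<Sum>i\<in>A. (i + 1) * Poly_Mapping.lookup m i)"
  unfolding monom_degree_def using assms
  by (intro sum.mono_neutral_left) (auto simp: in_keys_iff)

lemma monom_degree_add: "monom_degree (m + n) = monom_degree m + monom_degree n"
proof -
  let ?A = "Poly_Mapping.keys m \<union> Poly_Mapping.keys n"
  have "monom_degree (m + n) = (\<Sum>i\<in>?A. (i + 1) * Poly_Mapping.lookup (m + n) i)"
    by (rule monom_degree_superset) (use keys_add[of m n] in auto)
  then show ?thesis
    by (simp add: monom_degree_superset[of ?A] lookup_add ring_distribs sum.distrib)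
qed

lemma deg_le_mono: "deg_le d f \<Longrightarrow> d \<le> e \<Longrightarrow> deg_le e f"
  by (auto simp: deg_le_def)

lemma homog_imp_deg_le: "homog d f \<Longrightarrow> deg_le d f"
  by (auto simp: deg_le_def homog_def)

lemma deg_le_0 [simp]: "deg_le d 0"
  by (simp add: deg_le_def)

lemma homog_0 [simp]: "homog d 0"
  by (simp add: homog_def)

lemma deg_le_add: "deg_le d f \<Longrightarrow> deg_le d g \<Longrightarrow> deg_le d (f + g)"
  using keys_add[of f g] by (auto simp: deg_le_def)

lemma homog_add: "homog d f \<Longrightarrow> homog d g \<Longrightarrow> homog d (f + g)"
  using keys_add[of f g] by (auto simp: homog_def)

lemma deg_le_sum: "(\<And>i. i \<in> A \<Longrightarrow> deg_le d (f i)) \<Longrightarrow> deg_le d (\<Sum>i\<in>A. f i)"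
  by (induction A rule: infinite_finite_induct) (auto intro: deg_le_add)

lemma homog_sum: "(\<And>i. i \<in> A \<Longrightarrow> homog d (f i)) \<Longrightarrow> homog d (\<Sum>i\<in>A. f i)"
  by (induction A rule: infinite_finite_induct) (auto intro: homog_add)

lemma deg_le_mult: "deg_le d f \<Longrightarrow> deg_le e g \<Longrightarrow> deg_le (d + e) (f * g)"
  using keys_mult[of f g] unfolding deg_le_def
  by (fastforce simp: monom_degree_add intro: add_mono)

lemma homog_mult: "homog d f \<Longrightarrow> homog e g \<Longrightarrow> homog (d + e) (f * g)"
  using keys_mult[of f g] unfolding homog_def
  by (fastforce simp: monom_degree_add)

lemma monom_degree_0 [simp]: "monom_degree 0 = 0"
  by (simp add: monom_degree_def)

lemma homog_const: "homog 0 (const_sym c)"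
  by (auto simp: homog_def const_sym_def split: if_splits)

lemma homog_1: "homog 0 1"
  using homog_const[of 1] by simp

lemma homog_const_mult: "homog d f \<Longrightarrow> homog d (const_sym c * f)"
  using homog_mult[OF homog_const] by simp

lemma deg_le_const_mult: "deg_le d f \<Longrightarrow> deg_le d (const_sym c * f)"
  using deg_le_mult[OF homog_imp_deg_le[OF homog_const]] by simp

lemma deg_le_diff:
  assumes "deg_le d f" "deg_le d g" shows "deg_le d (f - g)"
proof -
  have "const_sym (- 1) = - 1"
    using const_sym_add[of "- 1" 1] by (simp add: eq_neg_iff_add_eq_0)
  then have "f - g = f + const_sym (- 1) * g"
    by simp
  then show ?thesis
    using deg_le_add[OF assms(1) deg_le_const_mult[OF assms(2), of "- 1"]] by metis
qed

lemma homog_prod: "(\<And>i. i \<in> A \<Longrightarrow> homog (d i) (f i)) \<Longrightarrow> homog (\<Sum>i\<in>A. d i) (\<Prod>i\<in>A. f i)"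
  by (induction A rule: infinite_finite_induct) (auto intro: homog_mult homog_1)

text \<open>
  Lower-order perturbations of homogeneous factors perturb the product in lower order only: replace
  the factors one at a time.
\<close>

lemma deg_le_prod_diff:
  assumes "finite A" "\<And>i. i \<in> A \<Longrightarrow> homog (d i) (h i)"
    and "\<And>i. i \<in> A \<Longrightarrow> deg_le (d i - 1) (g i - h i)"
  shows "deg_le ((\<Sum>i\<in>A. d i) - 1) ((\<Prod>i\<in>A. g i) - (\<Prod>i\<in>A. h i))"
  using assms
proof (induction A rule: finite_induct)
  case (insert x A)
  have hA: "deg_le (\<Sum>i\<in>A. d i) (\<Prod>i\<in>A. h i)"
    by (intro homog_imp_deg_le homog_prod insert.prems) auto
  have IH: "deg_le ((\<Sum>i\<in>A. d i) - 1) ((\<Prod>i\<in>A. g i) - (\<Prod>i\<in>A. h i))"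
    using insert by simp
  have hx: "deg_le (d x) (h x)" and gx: "deg_le (d x - 1) (g x - h x)"
    using insert.prems by (auto intro: homog_imp_deg_le)
  have "g x = h x + (g x - h x)" by simp
  then have "deg_le (d x) (g x)"
    using hx gx by (metis deg_le_add deg_le_mono diff_le_self zle_diff1_eq le_cases linorder_not_le)
  from deg_le_mult[OF this IH] deg_le_mult[OF gx hA]
  have "deg_le ((\<Sum>i\<in>insert x A. d i) - 1)
     (g x * ((\<Prod>i\<in>A. g i) - (\<Prod>i\<in>A. h i)) + (g x - h x) * (\<Prod>i\<in>A. h i))"
    using insert.hyps by (intro deg_le_add) (simp_all add: algebra_simps)
  then show ?case using insert.hyps by (simp add: algebra_simps)
qed simp

lemma homog_fps_mult:
  assumes "\<And>n. homog (int n) (fps_nth F n)" "\<And>n. homog (int n) (fps_nth G n)"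
  shows "homog (int n) (fps_nth (F * G) n)"
  unfolding fps_mult_nth
proof (rule homog_sum)
  fix i assume "i \<in> {0..n}"
  then show "homog (int n) (fps_nth F i * fps_nth G (n - i))"
    using homog_mult[OF assms(1)[of i] assms(2)[of "n - i"]] by simp
qed

lemma homog_fps_power:
  assumes "\<And>n. homog (int n) (fps_nth F n)"
  shows "homog (int n) (fps_nth (F ^ k) n)"
  by (induction k arbitrary: n) (auto intro: homog_1 homog_fps_mult assms)

lemma homog_power_sum: "0 < k \<Longrightarrow> homog (int k) (power_sum k)"
  by (simp add: homog_def power_sum_def monom_degree_def of_nat_diff)

lemma homog_H_series: "homog (int n) (fps_nth H_series n)"
  unfolding H_series_def fps_compose_nth lift_fps_def fps_nth_Abs_fps
  by (intro homog_sum homog_const_mult homog_fps_power)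
    (auto intro!: homog_const_mult homog_power_sum)

lemma homog_complete_h: "homog k (complete_h k)"
  using homog_H_series[of "nat k"] by (auto simp: complete_h_def)

lemma multi_h_triangular:
  "(\<Sum>k\<le>n. multi_h a (int k) * const_sym (fps_nth (\<Prod>i=1..k. inv_u_minus (a (int i))) n))
     = fps_nth H_series n"
proof -
  have "(\<lambda>k. fps_const (multi_h a (int k)) * lift_fps (\<Prod>i=1..k. inv_u_minus (a (int i)))) sums H_series"
    using is_multi_h_multi_h[of a] by (simp add: is_multi_h_def)
  then show ?thesis
    by (subst (asm) triangular_sums_iff[OF lift_prod_nth_less]) (simp_all add: lift_fps_def)
qed

text \<open>
  The defining expansion of \<open>H\<close> is unitriangular with scalar coefficients, so solving it for
  \<open>h\<^bsub>k;a\<^esub>\<close> gives \<open>h\<^sub>k\<close> minus a scalar combination of the \<open>h\<^bsub>j;a\<^esub>\<close> with \<open>j < k\<close>.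
\<close>

lemma multi_h_minus_complete_h: "deg_le (k - 1) (multi_h a k - complete_h k)"
proof (cases "k < 0")
  case False
  define c where "c j n = const_sym (fps_nth (\<Prod>i=1..j. inv_u_minus (a (int i))) n)" for j n
  have diag: "c n n = 1" for n
    using lift_prod_nth_eq[where a = a and k = n] by (simp add: c_def lift_fps_def)
  have rec: "multi_h a (int n) - complete_h (int n) = 0 - (\<Sum>j<n. c j n * multi_h a (int j))" for n
    using multi_h_triangular[of a n] diag[of n]
    unfolding lessThan_Suc_atMost[symmetric] sum.lessThan_Suc c_def[symmetric]
    by (simp add: complete_h_def algebra_simps eq_diff_eq)
  have "deg_le (int n - 1) (multi_h a (int n) - complete_h (int n))" for n
  proof (induction n rule: less_induct)
    case (less n)
    show ?case unfolding rec
    proof (intro deg_le_diff deg_le_0 deg_le_sum)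
      fix j assume "j \<in> {..<n}"
      then have j: "j < n" by simp
      have "multi_h a (int j) = complete_h (int j) + (multi_h a (int j) - complete_h (int j))" by simp
      then have "deg_le (int j) (multi_h a (int j))"
        using less[OF j] homog_imp_deg_le[OF homog_complete_h[of "int j"]]
        by (metis deg_le_add deg_le_mono diff_le_eq less_add_one order.strict_implies_order)
      then have "deg_le (int n - 1) (multi_h a (int j))"
        by (rule deg_le_mono) (use j in simp)
      then show "deg_le (int n - 1) (c j n * multi_h a (int j))"
        unfolding c_def by (rule deg_le_const_mult)
    qed
  qed
  from this[of "nat k"] False show ?thesis by simp
qed (simp add: multi_h_def complete_h_def)

lemma sum_row_len:
  assumes "length \<mu> \<le> n"
  shows "(\<Sum>i<n. row_len \<mu> (i + 1)) = sum_list \<mu>"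
proof -
  have "(\<Sum>i<n. row_len \<mu> (i + 1)) = (\<Sum>i<length \<mu>. row_len \<mu> (i + 1))"
    using assms by (intro sum.mono_neutral_right) (auto simp: row_len_def)
  also have "\<dots> = sum_list \<mu>"
    by (simp add: row_len_def sum_list_sum_nth atLeast0LessThan)
  finally show ?thesis .
qed

text \<open>
  Every term of the Jacobi-Trudi determinant has the same degree \<open>|\<mu>|\<close>: a permutation preserves the sum
  of the column indices.
\<close>

lemma sum_det_degrees:
  assumes p: "p permutes {0..<n}" and "length \<mu> \<le> n"
  shows "(\<Sum>i=0..<n. int (row_len \<mu> (i + 1)) - int (i + 1) + int (p i + 1)) = int (sum_list \<mu>)"
proof -
  have "(\<Sum>i=0..<n. int (p i + 1)) = (\<Sum>i=0..<n. int (i + 1))"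
    using sum.permute[OF p, of "\<lambda>i. int (i + 1)"] by (simp add: o_def)
  then show ?thesis
    using sum_row_len[OF assms(2), symmetric]
    by (simp add: sum.distrib sum_subtractf atLeast0LessThan)
qed

lemma homog_signof: "homog 0 (signof p)"
  by (cases "evenperm p") (auto simp: sign_def homog_def)

lemma det_from_1_leibniz:
  "det_from_1 n e = (\<Sum>p | p permutes {0..<n}. signof p * (\<Prod>i=0..<n. e (i + 1) (p i + 1)))"
proof -
  have "(\<Prod>i=0..<n. mat n n (\<lambda>(i, j). e (i + 1) (j + 1)) $$ (i, p i)) = (\<Prod>i=0..<n. e (i + 1) (p i + 1))"
    if "p permutes {0..<n}" for p
    using permutes_in_image[OF that] by (intro prod.cong) auto
  then show ?thesis
    unfolding det_from_1_def by (subst det_def'[of _ n]) (auto intro!: sum.cong)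
qed

lemma homog_schur: "homog (int (sum_list \<mu>)) (schur \<mu>)"
proof -
  let ?n = "length \<mu>"
  have "homog (int (sum_list \<mu>))
      (signof p * (\<Prod>i=0..<?n. complete_h (int (row_len \<mu> (i + 1)) - int (i + 1) + int (p i + 1))))"
    if p: "p permutes {0..<?n}" for p
  proof -
    have "homog (0 + (\<Sum>i=0..<?n. int (row_len \<mu> (i + 1)) - int (i + 1) + int (p i + 1)))
      (signof p * (\<Prod>i=0..<?n. complete_h (int (row_len \<mu> (i + 1)) - int (i + 1) + int (p i + 1))))"
      by (intro homog_mult homog_signof homog_prod homog_complete_h)
    then show ?thesis
      by (simp only: sum_det_degrees[OF p order_refl] add_0)
  qed
  then show ?thesis
    unfolding schur_def schur_order_def det_from_1_leibniz
    by (intro homog_sum) simp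
qed

lemma multi_schur_minus_schur: "deg_le (int (sum_list \<mu>) - 1) (multi_schur a \<mu> - schur \<mu>)"
proof -
  let ?n = "length \<mu>"
  let ?d = "\<lambda>p i. int (row_len \<mu> (i + 1)) - int (i + 1) + int (p i + 1)"
  let ?P = "\<lambda>p. \<Prod>i=0..<?n. multi_h (seq_shift (1 - int (p i + 1)) a) (?d p i)"
  let ?Q = "\<lambda>p. \<Prod>i=0..<?n. complete_h (?d p i)"
  have "deg_le (int (sum_list \<mu>) - 1) (signof p * (?P p - ?Q p))"
    if p: "p permutes {0..<?n}" for p
  proof -
    have "deg_le ((\<Sum>i=0..<?n. ?d p i) - 1) (?P p - ?Q p)"
      by (rule deg_le_prod_diff) (auto intro: homog_complete_h multi_h_minus_complete_h)
    from deg_le_mult[OF homog_imp_deg_le[OF homog_signof[of p]] this]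
    show ?thesis using sum_det_degrees[OF p, of \<mu>] by simp
  qed
  then have "deg_le (int (sum_list \<mu>) - 1) (\<Sum>p | p permutes {0..<?n}. signof p * (?P p - ?Q p))"
    by (intro deg_le_sum) auto
  moreover have "multi_schur a \<mu> - schur \<mu> = (\<Sum>p | p permutes {0..<?n}. signof p * (?P p - ?Q p))"
    unfolding schur_def schur_order_def multi_schur_def multi_schur_order_def det_from_1_leibniz
    by (simp only: right_diff_distrib sum_subtractf)
  ultimately show ?thesis by simp
qed

lemma lookup_homogeneous_component:
  "Poly_Mapping.lookup (homogeneous_component d f) m
     = (if monom_degree m = d then Poly_Mapping.lookup f m else 0)"
  by (auto simp: homogeneous_component_def lookup_sum lookup_single when_def in_keys_iff)

lemma deg_le_iff_lookup: "deg_le d f \<longleftrightarrow> (\<forall>m. d < int (monom_degree m) \<longrightarrow> Poly_Mapping.lookup f m = 0)"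
  unfolding deg_le_def Ball_def in_keys_iff by (metis linorder_not_le)

lemma homog_iff_lookup: "homog d f \<longleftrightarrow> (\<forall>m. int (monom_degree m) \<noteq> d \<longrightarrow> Poly_Mapping.lookup f m = 0)"
  by (auto simp: homog_def in_keys_iff)

text \<open>
  A nonzero homogeneous \<open>s\<close> of degree \<open>d\<close> is the top component of \<open>f\<close> iff \<open>f\<close> and \<open>s\<close> differ
  in degrees less than \<open>d\<close> only. This linear form of the first property is what allows subtraction. For \<open>s = 0\<close>
  it can fail, which is why \<open>schur_neq_0\<close> has to be known.
\<close>

lemma top_component_eq_iff:
  assumes s: "homog (int d) s" "s \<noteq> 0"
  shows "top_component f = s \<longleftrightarrow> deg_le (int d - 1) (f - s)"
proof
  from s obtain m where m: "Poly_Mapping.lookup s m \<noteq> 0" by (metis lookup_zero poly_mapping_eqI)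
  then have md: "monom_degree m = d" using s(1) by (auto simp: homog_iff_lookup)
  {
    assume top: "top_component f = s"
    let ?M = "Max (monom_degree ` Poly_Mapping.keys f)"
    from top s have f: "f \<noteq> 0" and hc: "homogeneous_component ?M f = s"
      by (auto simp: top_component_def split: if_splits)
    have dM: "?M = d" using m md unfolding hc[symmetric] lookup_homogeneous_component
      by (auto split: if_splits)
    have le: "monom_degree x \<le> d" if "x \<in> Poly_Mapping.keys f" for x
      unfolding dM[symmetric] using that by simp
    show "deg_le (int d - 1) (f - s)"
      unfolding deg_le_iff_lookup
    proof (intro allI impI)
      fix x assume "int d - 1 < int (monom_degree x)"
      then show "Poly_Mapping.lookup (f - s) x = 0"
        using le[of x] by (cases "monom_degree x = d")
         (auto simp: lookup_minus hc[symmetric, unfolded dM] lookup_homogeneous_component in_keys_iff)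
    qed
  }
  {
    assume "deg_le (int d - 1) (f - s)"
    then have eq: "Poly_Mapping.lookup f x = Poly_Mapping.lookup s x" if "d \<le> monom_degree x" for x
      using that by (auto simp: deg_le_iff_lookup lookup_minus)
    have mk: "m \<in> Poly_Mapping.keys f" using m eq[of m] md by (simp add: in_keys_iff)
    have "monom_degree x \<le> d" if "x \<in> Poly_Mapping.keys f" for x
      using that eq[of x] s(1) by (force simp: in_keys_iff homog_iff_lookup)
    then have M: "Max (monom_degree ` Poly_Mapping.keys f) = d"
      using mk md by (intro Max_eqI) auto
    from mk have "f \<noteq> 0" by auto
    then show "top_component f = s"
      unfolding top_component_def M using eq s(1)
      by (intro poly_mapping_eqI) (auto simp: lookup_homogeneous_component homog_iff_lookup)
  }
qed

section \<open>Expansion in inverse products of linear factors\<close>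

text \<open>
  The coefficient of \<open>1/((u - a\<^sub>s) \<cdots> (u - a\<^bsub>s+k-1\<^esub>))\<close> in the expansion of \<open>F\<close>, a power series analogue of
  Newton interpolation: split off the constant term, then multiply the rest by
  \<open>u - a\<^sub>s = X\<^sup>-\<^sup>1 (1 - a\<^sub>s X)\<close> and continue from \<open>s + 1\<close>. The start \<open>s\<close> is an argument because the
  columns of the Jacobi-Trudi matrix use different shifts of \<open>a\<close>.
\<close>

fun newton_coeff :: "(int \<Rightarrow> complex) \<Rightarrow> int \<Rightarrow> complex fps \<Rightarrow> nat \<Rightarrow> complex" where
  "newton_coeff a s F 0 = fps_nth F 0"
| "newton_coeff a s F (Suc k) =
     newton_coeff a (s + 1) (fps_shift 1 F * (1 - fps_const (a s) * fps_X)) k"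

lemma newton_coeff_add: "newton_coeff a s (F + G) k = newton_coeff a s F k + newton_coeff a s G k"
  by (induction k arbitrary: s F G) (simp_all add: fps_shift_add distrib_right)

lemma fps_shift_const_mult: "fps_shift n (fps_const c * F :: complex fps) = fps_const c * fps_shift n F"
  by (rule fps_ext) simp

lemma newton_coeff_const_mult: "newton_coeff a s (fps_const c * F) k = c * newton_coeff a s F k"
  by (induction k arbitrary: s F) (simp_all add: fps_shift_const_mult mult.assoc)

lemma newton_coeff_0 [simp]: "newton_coeff a s 0 k = 0"
  by (induction k arbitrary: s) simp_all

lemma newton_coeff_sum: "newton_coeff a s (\<Sum>i\<in>A. F i) k = (\<Sum>i\<in>A. newton_coeff a s (F i) k)"
  by (induction A rule: infinite_finite_induct) (simp_all add: newton_coeff_add)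

lemma newton_coeff_1: "newton_coeff a s 1 k = (if k = 0 then 1 else 0)"
proof (cases k)
  case (Suc j)
  have "fps_shift 1 (1 :: complex fps) = 0" by (rule fps_ext) simp
  with Suc show ?thesis by simp
qed simp

lemma inv_u_minus_nth: "fps_nth (inv_u_minus c) n = (if n = 0 then 0 else c ^ (n - 1))"
proof -
  have "Abs_fps (\<lambda>n. c ^ n) * (1 - fps_const c * fps_X) = 1"
  proof (rule fps_ext)
    fix n show "fps_nth (Abs_fps (\<lambda>n. c ^ n) * (1 - fps_const c * fps_X)) n = fps_nth 1 n"
      by (cases n) (simp_all add: right_diff_distrib mult.assoc[symmetric])
  qed
  then have "inverse (1 - fps_const c * fps_X) = Abs_fps (\<lambda>n. c ^ n)"
    by (intro fps_inverse_unique) (simp add: mult.commute)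
  then show ?thesis by (simp add: inv_u_minus_def)
qed

lemma inv_u_minus_mult: "inv_u_minus c * (1 - fps_const c * fps_X) = fps_X"
proof -
  have "inverse (1 - fps_const c * fps_X) * (1 - fps_const c * fps_X) = 1"
    by (rule inverse_mult_eq_1) simp
  then show ?thesis by (simp add: inv_u_minus_def mult.assoc)
qed

lemma newton_coeff_inv_mult:
  "newton_coeff a s (inv_u_minus (a s) * G) 0 = 0"
  "newton_coeff a s (inv_u_minus (a s) * G) (Suc k) = newton_coeff a (s + 1) G k"
proof -
  show "newton_coeff a s (inv_u_minus (a s) * G) 0 = 0"
    by (simp add: inv_u_minus_nth)
  have "fps_shift 1 (inv_u_minus (a s) * G)
      = inverse (1 - fps_const (a s) * fps_X) * G"
    by (rule fps_ext) (simp add: inv_u_minus_def mult.assoc)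
  moreover have "inverse (1 - fps_const (a s) * fps_X) * (1 - fps_const (a s) * fps_X) = 1"
    by (rule inverse_mult_eq_1) simp
  ultimately have "fps_shift 1 (inv_u_minus (a s) * G) * (1 - fps_const (a s) * fps_X) = G"
    by (simp add: mult_ac)
  then show "newton_coeff a s (inv_u_minus (a s) * G) (Suc k) = newton_coeff a (s + 1) G k"
    by simp
qed

text \<open>
  Division by the \<open>r\<close> factors that precede the start of an expansion only shifts its coefficients.
\<close>

lemma newton_coeff_prod_mult:
  "newton_coeff a s ((\<Prod>t<r. inv_u_minus (a (s + int t))) * G) k
     = (if k < r then 0 else newton_coeff a (s + int r) G (k - r))"
proof (induction r arbitrary: s k)
  case (Suc r)
  have "(\<Prod>t<Suc r. inv_u_minus (a (s + int t))) * G
      = inv_u_minus (a s) * ((\<Prod>t<r. inv_u_minus (a ((s + 1) + int t))) * G)"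
    by (subst prod.lessThan_Suc_shift) (simp add: algebra_simps)
  then show ?case
    using Suc.IH[of "s + 1" "k - 1"]
    by (cases k) (simp_all only: newton_coeff_inv_mult, simp_all add: algebra_simps)
qed simp

lemma newton_coeff_cong:
  "(\<And>i. i \<le> k \<Longrightarrow> fps_nth F i = fps_nth G i) \<Longrightarrow> newton_coeff a s F k = newton_coeff a s G k"
proof (induction k arbitrary: s F G)
  case (Suc k)
  show ?case unfolding newton_coeff.simps
    by (rule Suc.IH) (auto simp: fps_mult_nth Suc.prems intro!: sum.cong)
qed simp

text \<open>
  The \<open>k\<close>-th coefficient sees \<open>F\<close> only up to \<open>X\<^sup>k\<close>, so \<open>F\<close> may be replaced by a partial sum of its
  expansion; on the basis elements themselves the coefficients are Kronecker deltas.
\<close>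

lemma newton_coeff_unique:
  assumes "\<And>n. (\<Sum>k\<le>n. g k * fps_nth (\<Prod>t<k. inv_u_minus (a (s + int t))) n) = fps_nth F n"
  shows "g k = newton_coeff a s F k"
proof -
  let ?T = "\<lambda>k. \<Prod>t<k. inv_u_minus (a (s + int t))"
  have T0: "fps_nth (?T j) n = 0" if "n < j" for j n
    using that by (simp add: inv_u_minus_def prod.distrib fps_X_power_mult_nth)
  have "newton_coeff a s F k = newton_coeff a s (\<Sum>j\<le>k. fps_const (g j) * ?T j) k"
  proof (rule newton_coeff_cong)
    fix i assume "i \<le> k"
    then have "(\<Sum>j\<le>k. g j * fps_nth (?T j) i) = (\<Sum>j\<le>i. g j * fps_nth (?T j) i)"
      by (intro sum.mono_neutral_right) (auto simp: T0)
    then show "fps_nth F i = fps_nth (\<Sum>j\<le>k. fps_const (g j) * ?T j) i"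
      by (simp add: fps_sum_nth assms)
  qed
  also have "\<dots> = (\<Sum>j\<le>k. g j * newton_coeff a s (?T j) k)"
    by (simp add: newton_coeff_sum newton_coeff_const_mult)
  also have "\<dots> = (\<Sum>j\<le>k. if j = k then g j else 0)"
  proof (rule sum.cong)
    fix j assume "j \<in> {..k}"
    then show "g j * newton_coeff a s (?T j) k = (if j = k then g j else 0)"
      using newton_coeff_prod_mult[of a s j 1 k] by (auto simp: newton_coeff_1)
  qed simp
  finally show ?thesis by simp
qed

text \<open>
  Iterate \<open>(u - c) / (u - b) = 1 + (b - c) / (u - b)\<close>.
\<close>

lemma newton_coeff_pole:
  "newton_coeff a s (inv_u_minus b) (Suc k) = (\<Prod>t<k. b - a (s + int t))"
proof (induction k arbitrary: s)
  case 0
  show ?case by (simp add: inv_u_minus_nth)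
next
  case (Suc k)
  let ?G = "inverse (1 - fps_const b * fps_X)"
  have G: "?G * (1 - fps_const b * fps_X) = 1"
    by (rule inverse_mult_eq_1) simp
  have sh: "fps_shift 1 (inv_u_minus b) = ?G"
    by (rule fps_ext) (simp add: inv_u_minus_def)
  have "fps_shift 1 (inv_u_minus b) * (1 - fps_const (a s) * fps_X)
      = ?G * (1 - fps_const b * fps_X) + fps_const (b - a s) * (fps_X * ?G)"
    unfolding sh by (simp add: algebra_simps fps_const_sub[symmetric] del: fps_const_sub)
  also have "\<dots> = 1 + fps_const (b - a s) * inv_u_minus b"
    unfolding G by (simp add: inv_u_minus_def)
  finally have "newton_coeff a s (inv_u_minus b) (Suc (Suc k))
      = (b - a s) * newton_coeff a (s + 1) (inv_u_minus b) (Suc k)"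
    unfolding newton_coeff.simps(2)[of a s _ "Suc k"]
    by (simp only: newton_coeff_add newton_coeff_const_mult newton_coeff_1) simp
  also have "\<dots> = (\<Prod>t<Suc k. b - a (s + int t))"
    by (subst prod.lessThan_Suc_shift) (simp only: Suc.IH, simp add: algebra_simps)
  finally show ?case .
qed

lemma eval_multi_h:
  assumes F: "\<And>n. eval_sym \<phi> (fps_nth H_series n) = fps_nth F n"
  shows "eval_sym \<phi> (multi_h (seq_shift r a) (int k)) = newton_coeff a (1 + r) F k"
proof (rule newton_coeff_unique)
  fix n
  have P: "(\<Prod>i=1..k. inv_u_minus (seq_shift r a (int i)))
      = (\<Prod>t<k. inv_u_minus (a (1 + r + int t)))" for k
    by (rule prod.reindex_bij_witness[of _ Suc "\<lambda>i. i - 1"]) (auto simp: seq_shift_def algebra_simps)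
  show "(\<Sum>k\<le>n. eval_sym \<phi> (multi_h (seq_shift r a) (int k)) *
      fps_nth (\<Prod>t<k. inv_u_minus (a (1 + r + int t))) n) = fps_nth F n"
    using arg_cong[OF multi_h_triangular[of "seq_shift r a" n], of "eval_sym \<phi>"]
    by (simp only: eval_sym_sum eval_sym_mult eval_sym_const P F)
qed

section \<open>The generating series at a Young diagram\<close>

lemma eval_fps_mult:
  assumes "\<And>n. eval_sym \<phi> (fps_nth A n) = fps_nth A' n" "\<And>n. eval_sym \<phi> (fps_nth B n) = fps_nth B' n"
  shows "eval_sym \<phi> (fps_nth (A * B) n) = fps_nth (A' * B') n"
  by (simp add: fps_mult_nth eval_sym_sum eval_sym_mult assms)

lemma eval_fps_power:
  assumes "\<And>n. eval_sym \<phi> (fps_nth B n) = fps_nth B' n"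
  shows "eval_sym \<phi> (fps_nth (B ^ i) n) = fps_nth (B' ^ i) n"
proof (induction i arbitrary: n)
  case (Suc i)
  show ?case unfolding power_Suc by (rule eval_fps_mult[OF assms Suc.IH])
qed simp

lemma eval_H_series_exp:
  "eval_sym \<phi> (fps_nth H_series n)
     = fps_nth (fps_exp 1 oo Abs_fps (\<lambda>k. if k = 0 then 0 else \<phi> k / of_nat k)) n"
proof -
  have "eval_sym \<phi> (fps_nth (Abs_fps (\<lambda>k. if k = 0 then 0 else const_sym (1 / of_nat k) * power_sum k)) m)
     = fps_nth (Abs_fps (\<lambda>k. if k = 0 then 0 else \<phi> k / of_nat k)) m" for m
    by (simp add: eval_sym_mult)
  from eval_fps_power[OF this] show ?thesis
    by (simp add: H_series_def fps_compose_nth eval_sym_sum eval_sym_mult lift_fps_def)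
qed

text \<open>
  The generating series is an exponential and its value at a diagram is to be a product. Both are
  pinned down by their logarithmic derivative \<open>L\<close>, which turns the product into a sum.
\<close>

lemma fps_log_deriv_unique:
  fixes E P :: "complex fps"
  assumes "fps_deriv E = L * E" "fps_deriv P = L * P" "fps_nth E 0 = fps_nth P 0"
  shows "E = P"
proof (rule fps_ext)
  fix n show "fps_nth E n = fps_nth P n"
  proof (induction n rule: less_induct)
    case (less n)
    show ?case
    proof (cases n)
      case (Suc m)
      have "fps_nth (L * E) m = fps_nth (L * P) m"
        unfolding fps_mult_nth by (intro sum.cong) (auto simp: less Suc)
      then have "of_nat n * fps_nth E n = of_nat n * fps_nth P n"
        using fps_deriv_nth[of E m] fps_deriv_nth[of P m] assms(1,2) Suc by simp
      then show ?thesis using Suc by (simp del: of_nat_Suc)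
    qed (use assms in simp)
  qed
qed

lemma inverse_one_minus_nth: "fps_nth (inverse (1 - fps_const (c::complex) * fps_X)) n = c ^ n"
  using inv_u_minus_nth[of c "Suc n"] by (simp add: inv_u_minus_def)

lemma inverse_one_minus: "inverse (1 - fps_const (c::complex) * fps_X) * (1 - fps_const c * fps_X) = 1"
  by (rule inverse_mult_eq_1) simp

lemma fps_log_deriv_prod:
  fixes F :: "'a \<Rightarrow> complex fps"
  assumes "\<And>i. i \<in> I \<Longrightarrow> fps_deriv (F i) = L i * F i"
  shows "fps_deriv (\<Prod>i\<in>I. F i) = (\<Sum>i\<in>I. L i) * (\<Prod>i\<in>I. F i)"
  using assms
  by (induction I rule: infinite_finite_induct) (simp_all add: algebra_simps)

lemma fps_log_deriv_ratio:
  fixes b c :: complex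
  defines "g \<equiv> \<lambda>z. inverse (1 - fps_const z * fps_X)"
  shows "fps_deriv ((1 - fps_const c * fps_X) * g b)
    = (fps_const b * g b - fps_const c * g c) * ((1 - fps_const c * fps_X) * g b)"
proof -
  have b: "g b * (1 - fps_const b * fps_X) = 1" and c: "g c * (1 - fps_const c * fps_X) = 1"
    unfolding g_def by (rule inverse_one_minus)+
  have "fps_deriv (g b) * (1 - fps_const b * fps_X) = fps_const b * g b"
    using arg_cong[OF b, of fps_deriv] by (simp add: algebra_simps)
  then have "fps_deriv (g b) * (g b * (1 - fps_const b * fps_X)) = fps_const b * g b * g b"
    by (metis mult.assoc mult.commute)
  then have db: "fps_deriv (g b) = fps_const b * g b * g b"
    by (simp add: b)
  have "fps_const c * g b = fps_const c * (g c * (1 - fps_const c * fps_X)) * g b"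
    by (simp add: c)
  with db show ?thesis by (simp add: algebra_simps)
qed

lemma fps_nth_0_prod:
  fixes F :: "'a \<Rightarrow> complex fps"
  shows "fps_nth (\<Prod>i\<in>I. F i) 0 = (\<Prod>i\<in>I. fps_nth (F i) 0)"
  by (induction I rule: infinite_finite_induct) simp_all

text \<open>
  With power sums \<open>\<phi>\<close>, the logarithmic derivative of \<open>exp (\<Sum> \<phi>\<^sub>k X\<^sup>k / k)\<close> is \<open>\<Sum> \<phi>\<^bsub>k+1\<^esub> X\<^sup>k\<close>,
  a sum of geometric series if \<open>\<phi>\<close> is a difference of power sums of numbers.
\<close>

lemma eval_H_series:
  assumes "\<And>k. 1 \<le> k \<Longrightarrow> \<phi> k = (\<Sum>i\<in>I. b i ^ k) - (\<Sum>i\<in>I. c i ^ k)"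
  shows "eval_sym \<phi> (fps_nth H_series n)
    = fps_nth (\<Prod>i\<in>I. (1 - fps_const (c i) * fps_X) * inverse (1 - fps_const (b i) * fps_X)) n"
proof -
  let ?L = "Abs_fps (\<lambda>k. if k = 0 then 0 else \<phi> k / of_nat k)"
  let ?g = "\<lambda>z::complex. inverse (1 - fps_const z * fps_X)"
  let ?P = "\<Prod>i\<in>I. (1 - fps_const (c i) * fps_X) * ?g (b i)"
  have L: "(\<Sum>i\<in>I. fps_const (b i) * ?g (b i) - fps_const (c i) * ?g (c i)) = fps_deriv ?L"
  proof (rule fps_ext)
    fix n
    have "(1 :: complex) + of_nat n \<noteq> 0" by (metis of_nat_Suc of_nat_neq_0)
    then show "fps_nth (\<Sum>i\<in>I. fps_const (b i) * ?g (b i) - fps_const (c i) * ?g (c i)) n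
        = fps_nth (fps_deriv ?L) n"
      by (simp add: fps_sum_nth inverse_one_minus_nth sum_subtractf assms)
  qed
  have "fps_exp 1 oo ?L = ?P"
  proof (rule fps_log_deriv_unique)
    show "fps_deriv (fps_exp 1 oo ?L) = fps_deriv ?L * (fps_exp 1 oo ?L)"
      by (simp add: fps_compose_deriv mult.commute)
    show "fps_deriv ?P = fps_deriv ?L * ?P"
      unfolding L[symmetric] by (intro fps_log_deriv_prod fps_log_deriv_ratio)
    show "fps_nth (fps_exp 1 oo ?L) 0 = fps_nth ?P 0"
      by (simp add: fps_nth_0_prod)
  qed
  then show ?thesis by (simp only: eval_H_series_exp)
qed

lemma row_len_antimono:
  assumes "is_diagram la" "1 \<le> i" "i \<le> j"
  shows "row_len la j \<le> row_len la i"
proof (cases "i = j \<or> length la < j")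
  case False
  with assms show ?thesis
    by (auto simp: row_len_def is_diagram_def sorted_wrt_iff_nth_less)
qed (auto simp: row_len_def)

lemma row_len_pos_iff:
  assumes "is_diagram la"
  shows "0 < row_len la i \<longleftrightarrow> 1 \<le> i \<and> i \<le> length la"
proof (cases "1 \<le> i \<and> i \<le> length la")
  case True
  then have "la ! (i - 1) \<in> set la" by (intro nth_mem) auto
  with assms have "la ! (i - 1) \<noteq> 0" by (metis is_diagram_def)
  with True show ?thesis by (simp add: row_len_def)
qed (auto simp: row_len_def)

text \<open>
  This turns the cardinalities that define column lengths and the diagonal length into inequalities.
\<close>

lemma downclosed_eq_atLeastAtMost_card:
  fixes S :: "nat set"
  assumes "finite S" "0 \<notin> S" "\<And>i j. i \<in> S \<Longrightarrow> 1 \<le> j \<Longrightarrow> j \<le> i \<Longrightarrow> j \<in> S"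
  shows "S = {1..card S}"
proof (cases "S = {}")
  case False
  have "S = {1..Max S}"
  proof (intro equalityI subsetI)
    fix i assume "i \<in> S"
    then show "i \<in> {1..Max S}" using assms(1,2) by (auto simp: Suc_le_eq intro: gr0I)
  next
    fix i assume "i \<in> {1..Max S}"
    then show "i \<in> S" using assms(3)[of "Max S" i] Max_in[OF assms(1) False] by auto
  qed
  then show ?thesis by (metis card_atLeastAtMost diff_Suc_1)
qed simp

lemma le_col_len_iff:
  assumes "is_diagram la" "1 \<le> i" "1 \<le> j"
  shows "i \<le> col_len la j \<longleftrightarrow> j \<le> row_len la i"
proof -
  let ?S = "{i. 1 \<le> i \<and> i \<le> length la \<and> j \<le> row_len la i}"
  have "?S = {1..col_len la j}"
    unfolding col_len_def
  proof (rule downclosed_eq_atLeastAtMost_card)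
    fix i k assume "i \<in> ?S" "1 \<le> k" "k \<le> i"
    then show "k \<in> ?S"
      using row_len_antimono[OF assms(1), of k i] by auto
  qed auto
  then have "i \<in> ?S \<longleftrightarrow> i \<in> {1..col_len la j}" by simp
  then show ?thesis
    using assms row_len_pos_iff[OF assms(1), of i] by auto
qed

lemma le_diag_len_iff:
  assumes "is_diagram la" "1 \<le> i"
  shows "i \<le> diag_len la \<longleftrightarrow> i \<le> row_len la i"
proof -
  let ?S = "{i. 1 \<le> i \<and> i \<le> length la \<and> i \<le> row_len la i}"
  have "?S = {1..diag_len la}"
    unfolding diag_len_def
  proof (rule downclosed_eq_atLeastAtMost_card)
    fix i j assume "i \<in> ?S" "1 \<le> j" "j \<le> i"
    then show "j \<in> ?S"
      using row_len_antimono[OF assms(1), of j i] by auto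
  qed auto
  then have "i \<in> ?S \<longleftrightarrow> i \<in> {1..diag_len la}" by simp
  then show ?thesis
    using assms row_len_pos_iff[OF assms(1), of i] by auto
qed

lemma col_len_antimono:
  assumes "is_diagram la" "1 \<le> i" "i \<le> j"
  shows "col_len la j \<le> col_len la i"
proof (cases "col_len la j = 0")
  case False
  then show ?thesis
    using le_col_len_iff[OF assms(1), of "col_len la j" j] le_col_len_iff[OF assms(1), of "col_len la j" i] assms
    by auto
qed simp

lemma diag_len_le_length: "diag_len la \<le> length la"
proof -
  have "diag_len la \<le> card {1..length la}"
    unfolding diag_len_def by (rule card_mono) auto
  then show ?thesis by simp
qed

text \<open>
  The classical complementarity of the Frobenius coordinates. A step of the boundary path of the diagram
  is either vertical (a row) or horizontal (a column), so \<open>\<lambda>\<^sub>j - j + 1\<close> and \<open>i - \<lambda>'\<^sub>i\<close> never coincide.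
  Equality of the sets then follows by counting: there are \<open>D\<close> columns and \<open>n - D\<close> rows, and the
  interval has \<open>n\<close> elements.
\<close>

lemma frobenius_complement:
  assumes la: "is_diagram la" and n: "length la \<le> n"
  shows "inj_on (\<lambda>i. - frob_Q la i) {1..diag_len la}"
    and "inj_on (\<lambda>i. frob_P la i + 1) {1..n}"
    and "(\<lambda>i. - frob_Q la i) ` {1..diag_len la} \<inter> (\<lambda>i. frob_P la i + 1) ` {diag_len la<..n} = {}"
    and "(\<lambda>i. - frob_Q la i) ` {1..diag_len la} \<union> (\<lambda>i. frob_P la i + 1) ` {diag_len la<..n}
      = {1 - int n..0}"
proof -
  let ?D = "diag_len la"
  let ?A = "(\<lambda>i. - frob_Q la i) ` {1..?D}" and ?B = "(\<lambda>i. frob_P la i + 1) ` {?D<..n}"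
  have D: "?D \<le> n" using diag_len_le_length[of la] n by simp
  show iA: "inj_on (\<lambda>i. - frob_Q la i) {1..?D}"
  proof (rule linorder_inj_onI)
    fix i j :: nat assume "i < j" "i \<in> {1..?D}"
    then show "- frob_Q la i \<noteq> - frob_Q la j"
      using col_len_antimono[OF la, of i j] by (simp add: frob_Q_def)
  qed auto
  show iB: "inj_on (\<lambda>i. frob_P la i + 1) {1..n}"
  proof (rule linorder_inj_onI)
    fix i j :: nat assume "i < j" "i \<in> {1..n}"
    then show "frob_P la i + 1 \<noteq> frob_P la j + 1"
      using row_len_antimono[OF la, of i j] by (simp add: frob_P_def)
  qed auto
  show disj: "?A \<inter> ?B = {}"
  proof -
    have "- frob_Q la i \<noteq> frob_P la j + 1" if "i \<in> {1..?D}" "j \<in> {?D<..n}" for i j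
      using le_col_len_iff[OF la, of j i] that
      by (cases "i \<le> row_len la j") (auto simp: frob_Q_def frob_P_def)
    then show ?thesis by auto
  qed
  have "?A \<subseteq> {1 - int n..0}"
  proof safe
    fix i assume i: "i \<in> {1..?D}"
    then have "i \<le> col_len la i"
      using le_diag_len_iff[OF la, of i] le_col_len_iff[OF la, of i i] by auto
    moreover have "col_len la i \<le> n"
      using i le_col_len_iff[OF la, of "col_len la i" i] row_len_pos_iff[OF la, of "col_len la i"] n
      by (cases "col_len la i = 0") auto
    ultimately show "- frob_Q la i \<in> {1 - int n..0}"
      using i by (auto simp: frob_Q_def)
  qed
  moreover have "?B \<subseteq> {1 - int n..0}"
  proof safe
    fix i assume "i \<in> {?D<..n}"
    then show "frob_P la i + 1 \<in> {1 - int n..0}"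
      using le_diag_len_iff[OF la, of i] by (auto simp: frob_P_def)
  qed
  moreover have "card (?A \<union> ?B) = card {1 - int n..0}"
  proof -
    have "card ?A = ?D" using card_image[OF iA] by simp
    moreover have "card ?B = n - ?D"
      by (subst card_image) (auto intro: inj_on_subset[OF iB])
    ultimately show ?thesis using D disj by (subst card_Un_disjoint) auto
  qed
  ultimately show "?A \<union> ?B = {1 - int n..0}"
    by (intro card_subset_eq) auto
qed

lemma frobenius_sum:
  fixes f :: "int \<Rightarrow> 'a::ab_group_add"
  assumes la: "is_diagram la" and n: "length la \<le> n"
  shows "(\<Sum>i=1..diag_len la. f (frob_P la i + 1)) - (\<Sum>i=1..diag_len la. f (- frob_Q la i))
    = (\<Sum>i<n. f (int (row_len la (i + 1)) - int i)) - (\<Sum>i<n. f (- int i))"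
proof -
  let ?D = "diag_len la"
  note fc = frobenius_complement[OF la n]
  have D: "?D \<le> n" using diag_len_le_length[of la] n by simp
  have sub: "{?D<..n} \<subseteq> {1..n}" by auto
  have "(\<Sum>i<n. f (- int i)) = sum f {1 - int n..0}"
    by (rule sum.reindex_bij_witness[of _ "\<lambda>z. nat (- z)" "\<lambda>i. - int i"]) auto
  also have "\<dots> = sum f ((\<lambda>i. - frob_Q la i) ` {1..?D}) + sum f ((\<lambda>i. frob_P la i + 1) ` {?D<..n})"
    unfolding fc(4)[symmetric] by (rule sum.union_disjoint) (use fc(3) in auto)
  also have "\<dots> = (\<Sum>i=1..?D. f (- frob_Q la i)) + (\<Sum>i\<in>{?D<..n}. f (frob_P la i + 1))"
    using fc(1) inj_on_subset[OF fc(2) sub] by (simp add: sum.reindex)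
  finally have 1: "(\<Sum>i<n. f (- int i)) = \<dots>" .
  have "(\<Sum>i<n. f (int (row_len la (i + 1)) - int i)) = (\<Sum>i=1..n. f (frob_P la i + 1))"
    by (rule sum.reindex_bij_witness[of _ "\<lambda>i. i - 1" Suc]) (auto simp: frob_P_def)
  also have "{1..n} = {1..?D} \<union> {?D<..n}" using D by auto
  also have "(\<Sum>i\<in>\<dots>. f (frob_P la i + 1))
      = (\<Sum>i=1..?D. f (frob_P la i + 1)) + (\<Sum>i\<in>{?D<..n}. f (frob_P la i + 1))"
    by (rule sum.union_disjoint) auto
  finally show ?thesis unfolding 1 by simp
qed

definition diagram_power_sum :: "(int \<Rightarrow> complex) \<Rightarrow> nat list \<Rightarrow> nat \<Rightarrow> complex" where
  "diagram_power_sum a la k =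
     (\<Sum>i | 1 \<le> i \<and> x_pt a la i \<noteq> 0. x_pt a la i ^ k)
     + (-1) ^ (k - 1) * (\<Sum>i | 1 \<le> i \<and> y_pt a la i \<noteq> 0. y_pt a la i ^ k)"

lemma vanishes_at_iff: "vanishes_at a f la \<longleftrightarrow> eval_sym (diagram_power_sum a la) f = 0"
  unfolding vanishes_at_def super_eval_def diagram_power_sum_def ..

text \<open>
  The sign \<open>(-1)\<^bsup>k-1\<^esup>\<close> and the sign in \<open>dual_seq\<close> combine to \<open>-1\<close>, so the \<open>y\<close>-part is subtracted, and the
  rows on the diagonal together with the complementarity give all \<open>n\<close> rows.
\<close>

lemma diagram_power_sum_eq:
  assumes "is_diagram la" "length la \<le> n" "1 \<le> k"
  shows "diagram_power_sum a la k
    = (\<Sum>i<n. a (int (row_len la (i + 1)) - int i) ^ k) - (\<Sum>i<n. a (- int i) ^ k)"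
proof -
  have "(\<Sum>i | 1 \<le> i \<and> x_pt a la i \<noteq> 0. x_pt a la i ^ k) = (\<Sum>i=1..diag_len la. x_pt a la i ^ k)"
    using assms(3) by (intro sum.mono_neutral_left) (auto simp: x_pt_def split: if_splits)
  also have "\<dots> = (\<Sum>i=1..diag_len la. a (frob_P la i + 1) ^ k)"
    by (rule sum.cong) (auto simp: x_pt_def)
  finally have x: "(\<Sum>i | 1 \<le> i \<and> x_pt a la i \<noteq> 0. x_pt a la i ^ k) = \<dots>" .
  have "(\<Sum>i | 1 \<le> i \<and> y_pt a la i \<noteq> 0. y_pt a la i ^ k) = (\<Sum>i=1..diag_len la. y_pt a la i ^ k)"
    using assms(3) by (intro sum.mono_neutral_left) (auto simp: y_pt_def split: if_splits)
  also have "\<dots> = (\<Sum>i=1..diag_len la. (- 1) ^ k * a (- frob_Q la i) ^ k)"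
    by (rule sum.cong) (auto simp: y_pt_def dual_seq_def power_mult_distrib[symmetric])
  finally have y: "(\<Sum>i | 1 \<le> i \<and> y_pt a la i \<noteq> 0. y_pt a la i ^ k)
      = (- 1) ^ k * (\<Sum>i=1..diag_len la. a (- frob_Q la i) ^ k)"
    by (simp add: sum_distrib_left)
  have sgn: "(- 1) ^ (k - 1) * (- 1) ^ k = (- 1 :: complex)"
    using assms(3) by (cases k) (simp_all add: power_add[symmetric] mult_2[symmetric])
  show ?thesis
    using frobenius_sum[OF assms(1,2), of "\<lambda>z. a z ^ k"]
    unfolding diagram_power_sum_def x y mult.assoc[symmetric] sgn by simp
qed

lemma eval_H_series_diagram:
  assumes "is_diagram la" "length la \<le> n"
  shows "eval_sym (diagram_power_sum a la) (fps_nth H_series m)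
    = fps_nth (\<Prod>i<n. (1 - fps_const (a (- int i)) * fps_X)
        * inverse (1 - fps_const (a (int (row_len la (i + 1)) - int i)) * fps_X)) m"
  by (rule eval_H_series) (rule diagram_power_sum_eq[OF assms])

section \<open>The determinant of values at a diagram\<close>

text \<open>
  In the variable \<open>u\<close>: a polynomial of degree \<open>m\<close> is a combination of the monic polynomials
  \<open>\<Prod>\<^bsub>i<j\<^esub> (u - c\<^sub>i)\<close> with \<open>j \<le> m\<close>. The statement is multiplied by \<open>X\<^sup>m\<close>, which makes it one about
  power series in \<open>X\<close>.
\<close>

lemma prod_linear_factors_expansion:
  fixes c :: "nat \<Rightarrow> complex"
  assumes "finite I"
  shows "\<exists>M. (\<Prod>i\<in>I. 1 - fps_const (d i) * fps_X)
    = (\<Sum>j\<le>card I. fps_const (M j) * fps_X ^ (card I - j) * (\<Prod>i<j. 1 - fps_const (c i) * fps_X))"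
  using assms
proof (induction I rule: finite_induct)
  case empty
  show ?case by (rule exI[of _ "\<lambda>_. 1"]) simp
next
  case (insert x I)
  define C where "C j = (\<Prod>i<j. 1 - fps_const (c i) * fps_X)" for j
  define m where "m = card I"
  from insert.IH obtain M where
    M: "(\<Prod>i\<in>I. 1 - fps_const (d i) * fps_X) = (\<Sum>j\<le>m. fps_const (M j) * fps_X ^ (m - j) * C j)"
    unfolding C_def m_def by blast
  \<comment> \<open>coefficients after multiplication by \<open>u - d\<^sub>x = (u - c\<^sub>j) + (c\<^sub>j - d\<^sub>x)\<close>\<close>
  define M' where "M' j = (if j = 0 then 0 else M (j - 1)) + (if j \<le> m then M j * (c j - d x) else 0)" for j
  have step: "(1 - fps_const (d x) * fps_X) * (fps_const (M j) * fps_X ^ (m - j) * C j)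
      = fps_const (M j) * fps_X ^ (Suc m - Suc j) * C (Suc j)
        + fps_const (M j * (c j - d x)) * fps_X ^ (Suc m - j) * C j" if "j \<le> m" for j
  proof -
    have C: "C (Suc j) = C j * (1 - fps_const (c j) * fps_X)"
      by (simp add: C_def)
    have "(1 - D * fps_X) * (A * Y * C j)
        = A * Y * (C j * (1 - E * fps_X)) + A * (E - D) * (fps_X * Y) * C j" for A D E Y :: "complex fps"
      by (simp add: algebra_simps)
    from this[of "fps_const (d x)" "fps_const (M j)" "fps_X ^ (m - j)" "fps_const (c j)"]
    show ?thesis using that by (simp add: C Suc_diff_le)
  qed
  have "(\<Prod>i\<in>insert x I. 1 - fps_const (d i) * fps_X)
      = (\<Sum>j\<le>m. fps_const (M j) * fps_X ^ (Suc m - Suc j) * C (Suc j)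
        + fps_const (M j * (c j - d x)) * fps_X ^ (Suc m - j) * C j)"
    unfolding prod.insert[OF insert.hyps] M sum_distrib_left
    by (rule sum.cong) (simp_all add: step del: diff_Suc_Suc)
  also have "\<dots> = (\<Sum>j\<le>m. fps_const (M j) * fps_X ^ (Suc m - Suc j) * C (Suc j))
        + (\<Sum>j\<le>m. fps_const (M j * (c j - d x)) * fps_X ^ (Suc m - j) * C j)"
    by (rule sum.distrib)
  also have "(\<Sum>j\<le>m. fps_const (M j) * fps_X ^ (Suc m - Suc j) * C (Suc j))
      = (\<Sum>j\<le>Suc m. fps_const (if j = 0 then 0 else M (j - 1)) * fps_X ^ (Suc m - j) * C j)"
    by (subst sum.atMost_Suc_shift) simp
  also have "(\<Sum>j\<le>m. fps_const (M j * (c j - d x)) * fps_X ^ (Suc m - j) * C j)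
      = (\<Sum>j\<le>Suc m. fps_const (if j \<le> m then M j * (c j - d x) else 0) * fps_X ^ (Suc m - j) * C j)"
    by (simp add: sum.atMost_Suc)
  also have "(\<Sum>j\<le>Suc m. fps_const (if j = 0 then 0 else M (j - 1)) * fps_X ^ (Suc m - j) * C j) + \<dots>
      = (\<Sum>j\<le>Suc m. fps_const (M' j) * fps_X ^ (Suc m - j) * C j)"
    unfolding sum.distrib[symmetric] M'_def fps_const_add[symmetric] distrib_right ..
  finally show ?case
    using insert.hyps unfolding C_def m_def by (intro exI[of _ M']) simp
qed

text \<open>
  This is the familiar strictly decreasing sequence \<open>\<lambda>\<^sub>i + n - i\<close>, its first entry being the one at index 0.
\<close>

definition shifted_row :: "nat \<Rightarrow> nat list \<Rightarrow> nat \<Rightarrow> nat" where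
  "shifted_row n la i = row_len la (i + 1) + (n - 1 - i)"

text \<open>
  Columns are numbered from 0. Column \<open>j\<close> expands the generating series from \<open>1 - j\<close> on. Dividing the series by
  \<open>(u - a\<^bsub>1-n\<^esub>) \<cdots> (u - a\<^bsub>-j\<^esub>)\<close> moves the start to \<open>1 - n\<close> for every column, and cancels the factors
  \<open>1 - a\<^sub>t X\<close> with \<open>t \<le> - j\<close> of its numerator. The index of the coefficient becomes the same in all columns, and the
  convention \<open>h\<^bsub>k;a\<^esub> = 0\<close> for \<open>k < 0\<close> holds automatically.
\<close>

lemma jacobi_trudi_entry:
  assumes la: "is_diagram la" "length la \<le> n" and i: "i < n" and j: "j < n"
  shows "eval_sym (diagram_power_sum a la)
      (multi_h (seq_shift (1 - int (j + 1)) a) (int (row_len \<mu> (i + 1)) - int (i + 1) + int (j + 1)))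
    = newton_coeff a (1 - int n)
        (fps_X ^ (n - j) * (\<Prod>t<j. 1 - fps_const (a (- int t)) * fps_X)
          * (\<Prod>t<n. inverse (1 - fps_const (a (int (row_len la (t + 1)) - int t)) * fps_X)))
        (Suc (shifted_row n \<mu> i))" (is "?lhs = newton_coeff a _ ?F _")
proof -
  let ?g = "\<lambda>z::complex. inverse (1 - fps_const z * fps_X)"
  let ?B = "\<Prod>t<n. ?g (a (int (row_len la (t + 1)) - int t))"
  let ?p = "\<lambda>t. 1 - fps_const (a (- int t)) * fps_X"
  let ?H = "\<Prod>t<n. ?p t * ?g (a (int (row_len la (t + 1)) - int t))"
  let ?k = "int (row_len \<mu> (i + 1)) - int (i + 1) + int (j + 1)"
  have "(\<Prod>t<n - j. inv_u_minus (a (1 - int n + int t))) = (\<Prod>t\<in>{j..<n}. inv_u_minus (a (- int t)))"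
    by (rule prod.reindex_bij_witness[of _ "\<lambda>t. n - 1 - t" "\<lambda>t. n - 1 - t"])
       (use j in \<open>auto simp: of_nat_diff algebra_simps\<close>)
  moreover have "?H = (\<Prod>t<j. ?p t) * (\<Prod>t\<in>{j..<n}. ?p t) * ?B"
    using j by (simp only: prod.distrib lessThan_atLeast0)
      (subst prod.atLeastLessThan_concat[of 0 j n], simp_all)
  ultimately have "(\<Prod>t<n - j. inv_u_minus (a (1 - int n + int t))) * ?H
      = (\<Prod>t\<in>{j..<n}. inv_u_minus (a (- int t)) * ?p t) * (\<Prod>t<j. ?p t) * ?B"
    by (simp add: prod.distrib mult_ac)
  also have "\<dots> = ?F"
    using j by (simp add: inv_u_minus_mult)
  finally have F: "?F = (\<Prod>t<n - j. inv_u_minus (a (1 - int n + int t))) * ?H" ..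
  have "newton_coeff a (1 - int n) ?F (Suc (shifted_row n \<mu> i))
      = (if Suc (shifted_row n \<mu> i) < n - j then 0
         else newton_coeff a (1 - int n + int (n - j)) ?H (Suc (shifted_row n \<mu> i) - (n - j)))"
    unfolding F by (rule newton_coeff_prod_mult)
  also have "\<dots> = ?lhs"
  proof (cases "?k < 0")
    case True
    then show ?thesis using i j by (simp add: multi_h_def shifted_row_def)
  next
    case False
    have k: "?k = int (Suc (shifted_row n \<mu> i) - (n - j))" and ge: "\<not> Suc (shifted_row n \<mu> i) < n - j"
      using False i j by (auto simp: shifted_row_def)
    have lhs: "?lhs = newton_coeff a (1 + (1 - int (j + 1))) ?H (Suc (shifted_row n \<mu> i) - (n - j))"
      unfolding k by (rule eval_multi_h) (rule eval_H_series_diagram[OF la])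
    have start: "1 + (1 - int (j + 1)) = 1 - int n + int (n - j)"
      using j by simp
    show ?thesis unfolding if_not_P[OF ge] lhs start ..
  qed
  finally show ?thesis ..
qed

text \<open>
  The entries are generalised powers \<open>(b\<^sub>l - a\<^bsub>1-n\<^esub>) (b\<^sub>l - a\<^bsub>2-n\<^esub>) \<cdots>\<close> with \<open>\<mu>\<^sub>i + n - i\<close> factors, as in the
  numerator of the bialternant formula for factorial Schur functions.
\<close>

definition generalised_power_matrix ::
    "(int \<Rightarrow> complex) \<Rightarrow> nat \<Rightarrow> nat list \<Rightarrow> nat list \<Rightarrow> complex mat" where
  "generalised_power_matrix a n \<mu> la = mat n n (\<lambda>(i, l). \<Prod>t<shifted_row n \<mu> i.
     a (int (row_len la (l + 1)) - int l) - a (1 - int n + int t))"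

text \<open>
  The matrix product of the values of the Jacobi-Trudi matrix with the coefficients \<open>M\<close> that write the
  poles \<open>1/(u - b\<^sub>l)\<close> in terms of the \<open>F\<^sub>j\<close> is the matrix of expansion coefficients of the poles.
  It matters that one \<open>m\<close>, the determinant of \<open>M\<close>, serves all \<open>\<mu>\<close>: its nonvanishing is read off from
  the single case \<open>\<mu> = \<lambda>\<close>, so the classical Vandermonde evaluation can be bypassed.
\<close>

lemma eval_multi_schur_det:
  assumes la: "is_diagram la" "length la \<le> n"
  shows "\<exists>m. \<forall>\<mu>. length \<mu> \<le> n \<longrightarrow>
    eval_sym (diagram_power_sum a la) (multi_schur a \<mu>) * m
      = det (generalised_power_matrix a n \<mu> la)"
proof -
  define b where "b l = a (int (row_len la (l + 1)) - int l)" for l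
  define g where "g z = inverse (1 - fps_const z * fps_X)" for z :: complex
  define B where "B = (\<Prod>t<n. g (b t))"
  define F where "F j = fps_X ^ (n - j) * (\<Prod>t<j. 1 - fps_const (a (- int t)) * fps_X) * B" for j
  have "\<exists>M. inv_u_minus (b l) = (\<Sum>j<n. fps_const (M j) * F j)" if l: "l < n" for l
  proof -
    let ?I = "{..<n} - {l}"
    have card: "card ?I = n - 1" using l by simp
    obtain M where M: "(\<Prod>i\<in>?I. 1 - fps_const (b i) * fps_X)
        = (\<Sum>j\<le>n - 1. fps_const (M j) * fps_X ^ (n - 1 - j) * (\<Prod>t<j. 1 - fps_const (a (- int t)) * fps_X))"
      using prod_linear_factors_expansion[of ?I b "\<lambda>t. a (- int t)"] unfolding card by auto
    have "B = g (b l) * (\<Prod>i\<in>?I. g (b i))"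
      unfolding B_def using l by (subst prod.remove[of _ l]) auto
    then have "(\<Prod>i\<in>?I. 1 - fps_const (b i) * fps_X) * B
        = g (b l) * (\<Prod>i\<in>?I. g (b i) * (1 - fps_const (b i) * fps_X))"
      by (simp add: prod.distrib mult_ac)
    also have "\<dots> = g (b l)"
      unfolding g_def inverse_one_minus by simp
    finally have "inv_u_minus (b l) = fps_X * ((\<Prod>i\<in>?I. 1 - fps_const (b i) * fps_X) * B)"
      by (simp add: inv_u_minus_def g_def)
    also have "\<dots> = (\<Sum>j\<le>n - 1. fps_const (M j) * F j)"
      unfolding M sum_distrib_left sum_distrib_right
    proof (rule sum.cong)
      fix j assume "j \<in> {..n - 1}"
      then have "n - j = Suc (n - 1 - j)" using l by simp
      then show "fps_X * (fps_const (M j) * fps_X ^ (n - 1 - j)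
          * (\<Prod>t<j. 1 - fps_const (a (- int t)) * fps_X) * B) = fps_const (M j) * F j"
        unfolding F_def by (simp add: mult_ac)
    qed simp
    also have "{..n - 1} = {..<n}" using l by auto
    finally show ?thesis by blast
  qed
  then obtain M where M: "\<And>l. l < n \<Longrightarrow> inv_u_minus (b l) = (\<Sum>j<n. fps_const (M l j) * F j)"
    by metis
  have "eval_sym (diagram_power_sum a la) (multi_schur a \<mu>) * det (mat n n (\<lambda>(j, l). M l j))
      = det (generalised_power_matrix a n \<mu> la)"
    if \<mu>: "length \<mu> \<le> n" for \<mu>
  proof -
    interpret comm_ring_hom "eval_sym (diagram_power_sum a la)" by (rule eval_sym_hom)
    let ?C = "mat n n (\<lambda>(i, j). newton_coeff a (1 - int n) (F j) (Suc (shifted_row n \<mu> i)))"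
    have ev: "eval_sym (diagram_power_sum a la) (multi_schur a \<mu>) = det ?C"
      unfolding multi_schur_order_eq[OF \<mu>, symmetric] multi_schur_order_def det_from_1_def hom_det[symmetric]
    proof (intro arg_cong[of _ _ det] eq_matI)
      fix i j assume "i < dim_row ?C" "j < dim_col ?C"
      then have ij: "i < n" "j < n" by auto
      show "map_mat (eval_sym (diagram_power_sum a la)) (mat n n (\<lambda>(i, j).
          multi_h (seq_shift (1 - int (j + 1)) a) (int (row_len \<mu> (i + 1)) - int (i + 1) + int (j + 1)))) $$ (i, j)
        = ?C $$ (i, j)"
        using jacobi_trudi_entry[OF la ij, of a \<mu>] ij
        by (simp only: index_map_mat index_mat dim_row_mat dim_col_mat split F_def B_def b_def g_def)
    qed auto
    have CM: "?C * mat n n (\<lambda>(j, l). M l j)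
        = mat n n (\<lambda>(i, l). \<Prod>t<shifted_row n \<mu> i. b l - a (1 - int n + int t))"
    proof (rule eq_matI)
      fix i l assume "i < dim_row (mat n n (\<lambda>(i, l). \<Prod>t<shifted_row n \<mu> i. b l - a (1 - int n + int t)))"
        "l < dim_col (mat n n (\<lambda>(i, l). \<Prod>t<shifted_row n \<mu> i. b l - a (1 - int n + int t)))"
      then have il: "i < n" "l < n" by auto
      have "(\<Sum>j<n. newton_coeff a (1 - int n) (F j) (Suc (shifted_row n \<mu> i)) * M l j)
          = newton_coeff a (1 - int n) (\<Sum>j<n. fps_const (M l j) * F j) (Suc (shifted_row n \<mu> i))"
        by (simp only: newton_coeff_sum newton_coeff_const_mult, intro sum.cong refl mult.commute)
      also have "\<dots> = (\<Prod>t<shifted_row n \<mu> i. b l - a (1 - int n + int t))"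
        unfolding M[OF il(2), symmetric] by (rule newton_coeff_pole)
      finally show "(?C * mat n n (\<lambda>(j, l). M l j)) $$ (i, l)
          = mat n n (\<lambda>(i, l). \<Prod>t<shifted_row n \<mu> i. b l - a (1 - int n + int t)) $$ (i, l)"
        using il by (simp add: scalar_prod_def atLeast0LessThan)
    qed auto
    show ?thesis
      unfolding generalised_power_matrix_def b_def[symmetric] ev CM[symmetric]
      by (rule det_mult[symmetric]) auto
  qed
  then show ?thesis by (intro exI allI impI)
qed

section \<open>Vanishing and nonvanishing\<close>

lemma sum_shifted_row:
  "length la \<le> n \<Longrightarrow> (\<Sum>i<n. shifted_row n la i) = sum_list la + (\<Sum>i<n. n - 1 - i)"
  by (simp only: shifted_row_def sum.distrib sum_row_len)

lemma shifted_row_strict_antimono: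
  "is_diagram la \<Longrightarrow> i < j \<Longrightarrow> j < n \<Longrightarrow> shifted_row n la j < shifted_row n la i"
  using row_len_antimono[of la "i + 1" "j + 1"] by (simp add: shifted_row_def)

text \<open>
  Summing the inequalities over all \<open>i\<close> gives \<open>|\<mu>| \<le> |\<lambda>|\<close>, so none of them can be strict.
\<close>

lemma permutes_dominated_eq:
  assumes p: "p permutes {0..<n}" and len: "length la \<le> n" "length \<mu> \<le> n"
    and le: "sum_list la \<le> sum_list \<mu>"
    and dom: "\<And>i. i < n \<Longrightarrow> shifted_row n \<mu> i \<le> shifted_row n la (p i)"
    and i: "i < n"
  shows "shifted_row n \<mu> i = shifted_row n la (p i)"
proof (rule ccontr)
  assume "shifted_row n \<mu> i \<noteq> shifted_row n la (p i)"
  then have "(\<Sum>i<n. shifted_row n \<mu> i) < (\<Sum>i<n. shifted_row n la (p i))"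
    using dom i by (intro sum_strict_mono_ex1) (auto simp: order.strict_iff_order intro!: bexI[of _ i])
  also have "\<dots> = (\<Sum>i<n. shifted_row n la i)"
    using sum.permute[OF p, of "shifted_row n la"] by (simp add: atLeast0LessThan o_def)
  finally show False
    using sum_shifted_row[OF len(1)] sum_shifted_row[OF len(2)] le by simp
qed

lemma diagram_eqI:
  assumes "is_diagram la" "is_diagram \<mu>" "length la \<le> n" "length \<mu> \<le> n"
    and eq: "\<And>i. i < n \<Longrightarrow> row_len la (i + 1) = row_len \<mu> (i + 1)"
  shows "la = \<mu>"
proof -
  have rows: "row_len la k = row_len \<mu> k" for k
    using eq[of "k - 1"] assms(3,4) by (cases "1 \<le> k \<and> k \<le> n") (auto simp: row_len_def)
  have "length la = length \<mu>"
    using row_len_pos_iff[OF assms(1)] row_len_pos_iff[OF assms(2)] rows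
    by (metis le_antisym le_refl linorder_not_le not_less_eq_eq le0 One_nat_def)
  then show ?thesis
  proof (rule nth_equalityI)
    fix i assume "i < length la"
    with \<open>length la = length \<mu>\<close> show "la ! i = \<mu> ! i"
      using rows[of "Suc i"] by (simp add: row_len_def)
  qed
qed

lemma strict_mono_permutes_eq:
  fixes p :: "nat \<Rightarrow> nat"
  assumes p: "p permutes {0..<n}" and mono: "\<And>i j. i < j \<Longrightarrow> j < n \<Longrightarrow> p i < p j" and "i < n"
  shows "p i = i"
proof -
  have ge: "j \<le> p j" if "j < n" for j
    using that
  proof (induction j)
    case (Suc j)
    with mono[of j "Suc j"] show ?case by simp
  qed simp
  have "(\<Sum>i<n. p i) = (\<Sum>i<n. i)"
    using sum.permute[OF p, of "\<lambda>i. i"] by (simp add: atLeast0LessThan o_def)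
  then show ?thesis
    using sum_strict_mono_ex1[of "{..<n}" "\<lambda>i. i" p] ge \<open>i < n\<close>
    by (metis finite_lessThan lessThan_iff less_irrefl order.not_eq_order_implies_strict)
qed

lemma generalised_power_matrix_carrier: "generalised_power_matrix a n \<mu> la \<in> carrier_mat n n"
  by (simp add: generalised_power_matrix_def)

lemma generalised_power_matrix_nonzero_iff:
  assumes "inj a" "i < n" "l < n"
  shows "generalised_power_matrix a n \<mu> la $$ (i, l) \<noteq> 0 \<longleftrightarrow> shifted_row n \<mu> i \<le> shifted_row n la l"
proof -
  have "a (int (row_len la (l + 1)) - int l) = a (1 - int n + int t) \<longleftrightarrow> t = shifted_row n la l" for t
    using assms by (auto simp: inj_eq shifted_row_def)
  then show ?thesis
    using assms(2,3) by (auto simp: generalised_power_matrix_def prod_zero_iff)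
qed

lemma nonzero_permutation_term:
  assumes "inj a" and len: "length la \<le> n" "length \<mu> \<le> n" "sum_list la \<le> sum_list \<mu>"
    and p: "p permutes {0..<n}"
    and nz: "(\<Prod>i=0..<n. generalised_power_matrix a n \<mu> la $$ (i, p i)) \<noteq> 0" and "i < n"
  shows "shifted_row n \<mu> i = shifted_row n la (p i)"
proof (rule permutes_dominated_eq[OF p len _ \<open>i < n\<close>])
  fix i assume "i < n"
  then have "generalised_power_matrix a n \<mu> la $$ (i, p i) \<noteq> 0" and "p i < n"
    using nz permutes_in_image[OF p, of i] by auto
  then show "shifted_row n \<mu> i \<le> shifted_row n la (p i)"
    using generalised_power_matrix_nonzero_iff[OF assms(1) \<open>i < n\<close>] by blast
qed

text \<open>
  A permutation with a nonzero term matches two strictly decreasing sequences with each other, hence it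
  is the identity, and the two sequences agree.
\<close>

lemma det_generalised_power_matrix_zero:
  assumes "inj a" and la: "is_diagram la" "length la \<le> n" and \<mu>: "is_diagram \<mu>" "length \<mu> \<le> n"
    and le: "sum_list la \<le> sum_list \<mu>" and ne: "la \<noteq> \<mu>"
  shows "det (generalised_power_matrix a n \<mu> la) = 0"
proof -
  have "(\<Prod>i=0..<n. generalised_power_matrix a n \<mu> la $$ (i, p i)) = 0" if p: "p permutes {0..<n}" for p
  proof (rule ccontr)
    assume nz: "(\<Prod>i=0..<n. generalised_power_matrix a n \<mu> la $$ (i, p i)) \<noteq> 0"
    have pn: "p i < n" if "i < n" for i using permutes_in_image[OF p, of i] that by simp
    note eq = nonzero_permutation_term[OF assms(1) la(2) \<mu>(2) le p nz]
    have mono: "p i < p j" if "i < j" "j < n" for i j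
    proof (rule ccontr)
      assume "\<not> p i < p j"
      then have "shifted_row n la (p i) \<le> shifted_row n la (p j)"
        using shifted_row_strict_antimono[OF la(1), of "p j" "p i" n] pn[of i] that
        by (cases "p i = p j") auto
      then show False
        using eq[of i] eq[of j] shifted_row_strict_antimono[OF \<mu>(1) that] that by simp
    qed
    have "la = \<mu>"
    proof (rule diagram_eqI[OF la(1) \<mu>(1) la(2) \<mu>(2)])
      fix i assume "i < n"
      then show "row_len la (i + 1) = row_len \<mu> (i + 1)"
        using eq[of i] strict_mono_permutes_eq[OF p mono, of i] by (simp add: shifted_row_def)
    qed
    with ne show False by simp
  qed
  then show ?thesis
    unfolding det_def'[OF generalised_power_matrix_carrier]
    by (intro sum.neutral ballI) simp
qed

lemma det_generalised_power_matrix_nonzero: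
  assumes "inj a" and \<mu>: "is_diagram \<mu>" "length \<mu> \<le> n"
  shows "det (generalised_power_matrix a n \<mu> \<mu>) \<noteq> 0"
proof -
  let ?E = "generalised_power_matrix a n \<mu> \<mu>"
  have "(\<Prod>i=0..<n. ?E $$ (i, p i)) = 0" if p: "p permutes {0..<n}" and "p \<noteq> id" for p
  proof (rule ccontr)
    assume nz: "(\<Prod>i=0..<n. ?E $$ (i, p i)) \<noteq> 0"
    have pn: "p i < n" if "i < n" for i using permutes_in_image[OF p, of i] that by simp
    have "p i = i" for i
    proof (cases "i < n")
      case True
      have "shifted_row n \<mu> i = shifted_row n \<mu> (p i)"
        by (rule nonzero_permutation_term[OF assms(1) \<mu>(2) \<mu>(2) order_refl p nz True])
      then show ?thesis
        using shifted_row_strict_antimono[OF \<mu>(1), of i "p i" n]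
          shifted_row_strict_antimono[OF \<mu>(1), of "p i" i n] True pn[OF True]
        by (cases i "p i" rule: linorder_cases) auto
    qed (use p in \<open>auto simp: permutes_def\<close>)
    with \<open>p \<noteq> id\<close> show False by (auto simp: fun_eq_iff)
  qed
  then have "det ?E = (\<Sum>p\<in>{id}. signof p * (\<Prod>i=0..<n. ?E $$ (i, p i)))"
    unfolding det_def'[OF generalised_power_matrix_carrier]
    by (intro sum.mono_neutral_right) (auto simp: permutes_id finite_permutations)
  also have "\<dots> = (\<Prod>i=0..<n. ?E $$ (i, i))" by simp
  also have "\<dots> \<noteq> 0"
    using generalised_power_matrix_nonzero_iff[OF assms(1)] by simp
  finally show ?thesis .
qed

text \<open>
  At \<open>\<mu> = \<lambda>\<close> the right-hand side is nonzero, which rules out \<open>m = 0\<close>.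
\<close>

lemma eval_multi_schur_det_normalised:
  assumes "inj a" and la: "is_diagram la" "length la \<le> n"
  shows "\<exists>m. m \<noteq> 0 \<and> (\<forall>\<mu>. length \<mu> \<le> n \<longrightarrow>
    eval_sym (diagram_power_sum a la) (multi_schur a \<mu>) * m
      = det (generalised_power_matrix a n \<mu> la))"
  using eval_multi_schur_det[OF la, of a] det_generalised_power_matrix_nonzero[OF assms] la(2)
  by (metis mult_zero_right)

lemma multi_schur_nonvanishing:
  assumes "inj a" "is_diagram la"
  shows "\<not> vanishes_at a (multi_schur a la) la"
  using eval_multi_schur_det_normalised[OF assms order_refl]
    det_generalised_power_matrix_nonzero[OF assms order_refl]
  unfolding vanishes_at_iff by (metis mult_zero_left order_refl)

lemma multi_schur_vanishes:
  assumes "inj a" "is_diagram la" "is_diagram \<mu>" "sum_list la \<le> sum_list \<mu>" "la \<noteq> \<mu>"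
  shows "vanishes_at a (multi_schur a \<mu>) la"
proof -
  let ?n = "max (length la) (length \<mu>)"
  have n: "length la \<le> ?n" "length \<mu> \<le> ?n" by auto
  show ?thesis
    using eval_multi_schur_det_normalised[OF assms(1,2) n(1)] n(2)
      det_generalised_power_matrix_zero[OF assms(1,2) n(1) assms(3) n(2) assms(4,5)]
    unfolding vanishes_at_iff by (metis mult_eq_0_iff)
qed

section \<open>Functions of bounded degree and their values at small diagrams\<close>

lemma finite_diagrams_less: "finite {\<nu>. is_diagram \<nu> \<and> sum_list \<nu> < N}"
proof (rule finite_subset)
  show "finite {xs. set xs \<subseteq> {..N} \<and> length xs \<le> N}"
    by (rule finite_lists_length_le) simp
  have "length \<nu> \<le> sum_list \<nu>" if "is_diagram \<nu>" for \<nu>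
    using that unfolding is_diagram_def by (induction \<nu>) auto
  then show "{\<nu>. is_diagram \<nu> \<and> sum_list \<nu> < N} \<subseteq> {xs. set xs \<subseteq> {..N} \<and> length xs \<le> N}"
    using member_le_sum_list by fastforce
qed

text \<open>
  The exponents of the monomial \<open>\<Prod>p\<^sub>k\<close>, with \<open>k\<close> ranging over the rows of \<open>\<nu>\<close>, with \<open>p\<^sub>k\<close> at index \<open>k - 1\<close>.
\<close>

definition power_sum_exponents :: "nat list \<Rightarrow> nat \<Rightarrow>\<^sub>0 nat" where
  "power_sum_exponents \<nu> = (\<Sum>k\<leftarrow>\<nu>. Poly_Mapping.single (k - 1) 1)"

text \<open>
  Row lengths with multiplicities are the same data as exponents. Only this direction is recorded: it
  bounds the number of monomials by the number of diagrams, the other bound being a consequence of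
  linear independence.
\<close>

lemma exists_diagram_of_monomial:
  "\<exists>\<nu>. is_diagram \<nu> \<and> sum_list \<nu> = monom_degree m \<and> power_sum_exponents \<nu> = m"
proof -
  define s where "s xs = (\<Sum>k\<leftarrow>xs. Poly_Mapping.single (k - 1) (1::nat))" for xs :: "nat list"
  have deg: "monom_degree (s xs) = sum_list xs" if "0 \<notin> set xs" for xs
    using that by (induction xs) (auto simp: s_def monom_degree_add monom_degree_def[of "Poly_Mapping.single _ _"])
  have rep: "s (replicate j (Suc i)) = Poly_Mapping.single i j" for i j
    by (induction j) (auto simp: s_def single_add[symmetric])
  have app: "s (xs @ ys) = s xs + s ys" for xs ys
    by (simp add: s_def)
  have "\<exists>xs. 0 \<notin> set xs \<and> s xs = (\<Sum>i\<in>A. Poly_Mapping.single i (Poly_Mapping.lookup m i))"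
    if "finite A" for A
    using that
  proof (induction A rule: finite_induct)
    case empty
    show ?case by (intro exI[of _ "[]"]) (simp add: s_def)
  next
    case (insert i A)
    then obtain xs where "0 \<notin> set xs" "s xs = (\<Sum>i\<in>A. Poly_Mapping.single i (Poly_Mapping.lookup m i))"
      by blast
    with insert.hyps show ?case
      by (intro exI[of _ "replicate (Poly_Mapping.lookup m i) (Suc i) @ xs"]) (auto simp: app rep)
  qed
  from this[OF finite_keys[of m]] obtain xs where
    xs: "0 \<notin> set xs" "s xs = (\<Sum>i\<in>Poly_Mapping.keys m. Poly_Mapping.single i (Poly_Mapping.lookup m i))"
    by blast
  have m: "s xs = m"
    unfolding xs(2) by (rule poly_mapping_eqI) (auto simp: lookup_sum lookup_single when_def in_keys_iff)
  let ?\<nu> = "rev (sort xs)"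
  have perm: "s ?\<nu> = s xs"
  proof -
    have "s ys = (\<Sum>k\<in>#mset ys. Poly_Mapping.single (k - 1) 1)" for ys
      unfolding s_def by (simp only: sum_mset_sum_list[symmetric] mset_map)
    then show ?thesis by (simp only: mset_rev mset_sort)
  qed
  moreover have "is_diagram ?\<nu>"
    using xs(1) by (simp add: is_diagram_def sorted_wrt_rev)
  moreover have "sum_list ?\<nu> = monom_degree m"
    using deg[of ?\<nu>] xs(1) perm m by simp
  ultimately show ?thesis
    using m unfolding power_sum_exponents_def s_def by metis
qed

lemma finite_monomials_less: "finite {m. monom_degree m < N}"
  and card_monomials_less: "card {m. monom_degree m < N} \<le> card {\<nu>. is_diagram \<nu> \<and> sum_list \<nu> < N}"
proof -
  have sub: "{m. monom_degree m < N} \<subseteq> power_sum_exponents ` {\<nu>. is_diagram \<nu> \<and> sum_list \<nu> < N}"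
  proof
    fix m assume "m \<in> {m. monom_degree m < N}"
    then show "m \<in> power_sum_exponents ` {\<nu>. is_diagram \<nu> \<and> sum_list \<nu> < N}"
      using exists_diagram_of_monomial[of m] by auto
  qed
  show "finite {m. monom_degree m < N}"
    using sub finite_diagrams_less finite_subset by blast
  show "card {m. monom_degree m < N} \<le> card {\<nu>. is_diagram \<nu> \<and> sum_list \<nu> < N}"
    using card_mono[OF finite_imageI[OF finite_diagrams_less] sub]
      card_image_le[OF finite_diagrams_less] le_trans by blast
qed

interpretation symfun: vector_space "\<lambda>c f. const_sym c * f"
  by unfold_locales (simp_all add: distrib_left distrib_right const_sym_add const_sym_mult mult.assoc)

text \<open>
  Triangularity: evaluate at \<open>\<nu>\<close>, in order of increasing size. Terms of smaller size have coefficient zero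
  by induction, and all other terms except the one of \<open>\<nu>\<close> vanish there.
\<close>

lemma multi_schur_coeffs_zero:
  assumes a: "inj a" and fin: "finite P" and diag: "\<And>\<nu>. \<nu> \<in> P \<Longrightarrow> is_diagram \<nu>"
    and van: "\<And>la. la \<in> P \<Longrightarrow> vanishes_at a (\<Sum>\<nu>\<in>P. const_sym (c \<nu>) * multi_schur a \<nu>) la"
    and \<nu>: "\<nu> \<in> P"
  shows "c \<nu> = 0"
  using \<nu>
proof (induction "sum_list \<nu>" arbitrary: \<nu> rule: less_induct)
  case less
  let ?ev = "eval_sym (diagram_power_sum a \<nu>)"
  have "c \<kappa> * ?ev (multi_schur a \<kappa>) = 0" if \<kappa>: "\<kappa> \<in> P" "\<kappa> \<noteq> \<nu>" for \<kappa>
  proof (cases "sum_list \<kappa> < sum_list \<nu>")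
    case True
    with less.hyps \<kappa>(1) show ?thesis by simp
  next
    case False
    then show ?thesis
      using multi_schur_vanishes[OF a diag[OF less.prems] diag[OF \<kappa>(1)]] \<kappa>(2)
      by (simp add: vanishes_at_iff)
  qed
  then have "(\<Sum>\<kappa>\<in>P - {\<nu>}. c \<kappa> * ?ev (multi_schur a \<kappa>)) = 0"
    by (intro sum.neutral) auto
  then have "c \<nu> * ?ev (multi_schur a \<nu>) = 0"
    using van[OF less.prems]
    unfolding vanishes_at_iff eval_sym_sum eval_sym_mult eval_sym_const
    by (simp add: sum.remove[OF fin less.prems])
  then show ?case
    using multi_schur_nonvanishing[OF a diag[OF less.prems]] by (simp add: vanishes_at_iff)
qed

lemma deg_le_imp_in_span_monomials:
  assumes "deg_le d f"
  shows "f \<in> symfun.span ((\<lambda>m. Poly_Mapping.single m 1) ` {m. int (monom_degree m) \<le> d})"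
proof -
  have "f = (\<Sum>m\<in>Poly_Mapping.keys f. const_sym (Poly_Mapping.lookup f m) * Poly_Mapping.single m 1)"
    by (subst symfun_eq_sum_monomials) (simp add: const_sym_def mult_single)
  also have "\<dots> \<in> symfun.span ((\<lambda>m. Poly_Mapping.single m 1) ` {m. int (monom_degree m) \<le> d})"
    using assms by (intro symfun.span_sum symfun.span_scale symfun.span_base) (auto simp: deg_le_def)
  finally show ?thesis .
qed

lemma deg_le_multi_schur: "deg_le (int (sum_list \<mu>)) (multi_schur a \<mu>)"
proof -
  have "deg_le (int (sum_list \<mu>)) ((multi_schur a \<mu> - schur \<mu>) + schur \<mu>)"
    by (intro deg_le_add homog_imp_deg_le homog_schur deg_le_mono[OF multi_schur_minus_schur]) simp
  then show ?thesis by simp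
qed

text \<open>
  A dimension count replaces any explicit expansion in Schur functions: the independent family of the
  \<open>s\<^bsub>\<nu>;a\<^esub>\<close> with \<open>|\<nu>| < N\<close> is at least as large as the set of monomials of degree less than \<open>N\<close> in
  whose span it lies, hence it spans as well, and \<open>f\<close> has coefficients to which triangularity applies.
\<close>

lemma vanishing_low_degree_eq_0:
  assumes a: "inj a" and deg: "deg_le (int N - 1) f"
    and van: "\<And>la. is_diagram la \<Longrightarrow> sum_list la < N \<Longrightarrow> vanishes_at a f la"
  shows "f = 0"
proof -
  define P where "P = {\<nu>. is_diagram \<nu> \<and> sum_list \<nu> < N}"
  define T where "T = (\<lambda>m. Poly_Mapping.single m (1::complex)) ` {m. monom_degree m < N}"
  define B where "B = multi_schur a ` P"
  have P: "finite P" "\<And>\<nu>. \<nu> \<in> P \<Longrightarrow> is_diagram \<nu>"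
    unfolding P_def by (auto intro: finite_diagrams_less)
  have T: "T = (\<lambda>m. Poly_Mapping.single m 1) ` {m. int (monom_degree m) \<le> int N - 1}"
    unfolding T_def by (rule arg_cong[of _ _ "image _"]) auto
  have finT: "finite T"
    unfolding T_def by (intro finite_imageI finite_monomials_less)
  have inj: "inj_on (multi_schur a) P"
  proof (rule inj_onI)
    fix \<kappa> \<nu> assume kn: "\<kappa> \<in> P" "\<nu> \<in> P" "multi_schur a \<kappa> = multi_schur a \<nu>"
    have "\<kappa> = \<nu>" if "sum_list \<kappa> \<le> sum_list \<nu>" "\<kappa> \<in> P" "\<nu> \<in> P" "multi_schur a \<kappa> = multi_schur a \<nu>" for \<kappa> \<nu>
      using multi_schur_vanishes[OF a P(2)[OF that(2)] P(2)[OF that(3)] that(1)]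
        multi_schur_nonvanishing[OF a P(2)[OF that(2)]] that(4) by metis
    then show "\<kappa> = \<nu>" using kn nat_le_linear by metis
  qed
  have indep: "symfun.independent B"
  proof (rule symfun.independent_if_scalars_zero)
    show "finite B" unfolding B_def using P(1) by simp
    fix c x assume c: "(\<Sum>x\<in>B. const_sym (c x) * x) = 0" and "x \<in> B"
    then obtain \<nu> where \<nu>: "\<nu> \<in> P" "x = multi_schur a \<nu>" by (auto simp: B_def)
    have "(\<Sum>\<nu>\<in>P. const_sym (c (multi_schur a \<nu>)) * multi_schur a \<nu>) = 0"
      using c unfolding B_def by (simp add: sum.reindex[OF inj])
    then show "c x = 0"
      unfolding \<nu>(2)
      by (intro multi_schur_coeffs_zero[OF a P, of "\<lambda>\<nu>. c (multi_schur a \<nu>)"] \<nu>(1)) (simp_all add: vanishes_at_iff)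
  qed
  have BT: "B \<subseteq> symfun.span T"
  proof
    fix x assume "x \<in> B"
    then obtain \<nu> where "\<nu> \<in> P" "x = multi_schur a \<nu>" by (auto simp: B_def)
    then have "deg_le (int N - 1) x"
      using deg_le_mono[OF deg_le_multi_schur, of \<nu> "int N - 1"] by (simp add: P_def)
    then show "x \<in> symfun.span T"
      unfolding T by (rule deg_le_imp_in_span_monomials)
  qed
  have cards: "card T \<le> card B"
    using card_monomials_less[of N] card_image_le[OF finite_monomials_less, of "\<lambda>m. Poly_Mapping.single m (1::complex)" N] card_image[OF inj]
    unfolding T_def B_def P_def by linarith
  \<comment> \<open>an element of \<open>T\<close> outside the span would extend \<open>B\<close> to an independent set larger than \<open>T\<close>\<close>
  have "T \<subseteq> symfun.span B"
  proof (rule ccontr)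
    assume "\<not> T \<subseteq> symfun.span B"
    then obtain x where x: "x \<in> T" "x \<notin> symfun.span B" by blast
    then have "x \<notin> B" using symfun.span_base by blast
    have "symfun.independent (insert x B)"
      using indep x(2) by (rule symfun.independent_insertI[rotated])
    moreover have "insert x B \<subseteq> symfun.span T"
      using BT symfun.span_base[OF x(1)] by simp
    ultimately have "card (insert x B) \<le> card T"
      using symfun.independent_span_bound[OF finT] by blast
    with cards \<open>x \<notin> B\<close> P(1) show False by (simp add: B_def)
  qed
  then have "f \<in> symfun.span B"
    using deg_le_imp_in_span_monomials[OF deg] symfun.span_mono symfun.span_span
    unfolding T by blast
  then obtain c where "f = (\<Sum>x\<in>B. const_sym (c x) * x)"
    using symfun.span_finite[of B] P(1) by (auto simp: B_def)
  then have f: "f = (\<Sum>\<nu>\<in>P. const_sym (c (multi_schur a \<nu>)) * multi_schur a \<nu>)"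
    unfolding B_def by (simp add: sum.reindex[OF inj])
  have "c (multi_schur a \<nu>) = 0" if "\<nu> \<in> P" for \<nu>
  proof (rule multi_schur_coeffs_zero[OF a P _ that, of "\<lambda>\<nu>. c (multi_schur a \<nu>)"])
    fix la assume "la \<in> P"
    then show "vanishes_at a (\<Sum>\<nu>\<in>P. const_sym (c (multi_schur a \<nu>)) * multi_schur a \<nu>) la"
      unfolding f[symmetric] using van by (simp add: P_def)
  qed
  then show ?thesis unfolding f by (simp cong: sum.cong)
qed

text \<open>
  Choose any distinct \<open>a\<^sub>i\<close>. If \<open>s\<^sub>\<mu>\<close> were zero, \<open>s\<^bsub>\<mu>;a\<^esub>\<close> would have degree less than
  \<open>|\<mu>|\<close> and vanish at all diagrams with fewer than \<open>|\<mu>|\<close> boxes, so it would be zero; but it does not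
  vanish at \<open>\<mu>\<close>.
\<close>

lemma schur_neq_0:
  assumes "is_diagram \<mu>"
  shows "schur \<mu> \<noteq> 0"
proof
  assume 0: "schur \<mu> = 0"
  define a :: "int \<Rightarrow> complex" where "a = of_int"
  have a: "inj a" by (auto simp: a_def inj_def)
  have "multi_schur a \<mu> = 0"
  proof (rule vanishing_low_degree_eq_0[OF a])
    show "deg_le (int (sum_list \<mu>) - 1) (multi_schur a \<mu>)"
      using multi_schur_minus_schur[of \<mu> a] 0 by simp
    show "vanishes_at a (multi_schur a \<mu>) la" if "is_diagram la" "sum_list la < sum_list \<mu>" for la
      using multi_schur_vanishes[OF a that(1) assms] that(2) by auto
  qed
  then show False
    using multi_schur_nonvanishing[OF a assms] by (simp add: vanishes_at_iff)
qed

theorem theorem5p5: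
  fixes a :: "int \<Rightarrow> complex" and \<mu> :: "nat list"
  assumes "is_diagram \<mu>" and "inj a"
  shows "\<forall>f :: symfun.
    (top_component f = schur \<mu> \<and>
     (\<forall>la. is_diagram la \<and> sum_list la \<le> sum_list \<mu> \<and> la \<noteq> \<mu> \<longrightarrow> vanishes_at a f la))
    \<longleftrightarrow> f = multi_schur a \<mu>"
proof (intro allI iffI conjI impI)
  note top = top_component_eq_iff[OF homog_schur schur_neq_0[OF assms(1)]]
  fix f :: symfun
  {
    assume f: "top_component f = schur \<mu> \<and>
      (\<forall>la. is_diagram la \<and> sum_list la \<le> sum_list \<mu> \<and> la \<noteq> \<mu> \<longrightarrow> vanishes_at a f la)"
    have "f - multi_schur a \<mu> = 0"
    proof (rule vanishing_low_degree_eq_0[OF assms(2)])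
      have "deg_le (int (sum_list \<mu>) - 1) ((f - schur \<mu>) - (multi_schur a \<mu> - schur \<mu>))"
        using f top[of f] by (intro deg_le_diff[OF _ multi_schur_minus_schur]) simp
      then show "deg_le (int (sum_list \<mu>) - 1) (f - multi_schur a \<mu>)" by simp
    next
      fix la assume la: "is_diagram la" "sum_list la < sum_list \<mu>"
      then have ne: "la \<noteq> \<mu>" by auto
      then have "vanishes_at a f la" using f la by simp
      moreover have "vanishes_at a (multi_schur a \<mu>) la"
        using multi_schur_vanishes[OF assms(2) la(1) assms(1) _ ne] la(2) by simp
      ultimately show "vanishes_at a (f - multi_schur a \<mu>) la"
        by (simp add: vanishes_at_iff eval_sym_diff)
    qed
    then show "f = multi_schur a \<mu>" by simp
  }
  {
    assume f: "f = multi_schur a \<mu>"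
    show "top_component f = schur \<mu>"
      unfolding top f by (rule multi_schur_minus_schur)
    fix la assume la: "is_diagram la \<and> sum_list la \<le> sum_list \<mu> \<and> la \<noteq> \<mu>"
    then show "vanishes_at a f la"
      unfolding f using multi_schur_vanishes[OF assms(2) _ assms(1)] by simp
  }
qed

end
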